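(* Suppose that $X, Y$ are metric spaces, $Z \subset X$ is a closed set with $\dim_{\rm N} Z \le n < \infty$, and $f \colon Z \to Y$ is a Lipschitz map. If $Y$ is Lipschitz $m$-connected for $m = 0,1,\dots,n$, then there is a Lipschitz extension $\bar f \colon X \to Y$ of $f$.
   Context: A family $(B_i)_{i\in I}$ of subsets of a metric space $X=(X,d)$ is called $D$-bounded ($D \ge 0$) if $\operatorname{diam} B_i := \sup\{d(x,x') : x,x'\in B_i\} \le D$ for all $i$. For $s>0$, the $s$-multiplicity of the family is the infimum of all integers $n \ge 0$ such that every subset of $X$ with diameter $\le s$ meets at most $n$ members of the family. The Nagata dimension $\dim_{\rm N} X$ of a metric space $X$ is the infimum of all integers $n$ with the following property: there exists a constant $c>0$ such that for all $s>0$, $X$ has a $cs$-bounded covering with $s$-multiplicity at most $n+1$ (the value is $\infty$ if there is no such $n$). Subsets carry the induced metric. $\operatorname{Lip}(f)$ denotes the (smallest) Lipschitz constant of a Lipschitz map $f$. A metric space $Y$ is called Lipschitz $m$-connected, for an integer $m \ge 0$, if there is a constant $c_m$ such that every Lipschitz map $f \colon S^m \to Y$ has a Lipschitz extension $\bar f \colon B^{m+1} \to Y$ with $\operatorname{Lip}(\bar f) \le c_m \operatorname{Lip}(f)$; here $S^m$ and $B^{m+1}$ denote the unit sphere and closed unit ball in $\mathbb{R}^{m+1}$ equipped with the metric induced from $\mathbb{R}^{m+1}$. *)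

theory Defs
  imports "HOL-Analysis.Analysis"
begin

section \<open>Nagata dimension\<close>

text \<open>The real-valued \<^const>\<open>diameter\<close> is a meaningful supremum only on bounded sets, hence
  the first conjunct. The empty set has diameter 0.\<close>

definition diam_at_most :: "'a::metric_space set \<Rightarrow> real \<Rightarrow> bool" where
  "diam_at_most A D \<longleftrightarrow> bounded A \<and> diameter A \<le> D"

definition bounded_family :: "real \<Rightarrow> 'i set \<Rightarrow> ('i \<Rightarrow> 'a::metric_space set) \<Rightarrow> bool" where
  "bounded_family D I B \<longleftrightarrow> (\<forall>i\<in>I. diam_at_most (B i) D)"

text \<open>Members of the family are counted by index; the value is \<open>\<infinity>\<close> if there is no admissible
  natural number.\<close>

definition s_multiplicity ::
  "real \<Rightarrow> 'a::metric_space set \<Rightarrow> 'i set \<Rightarrow> ('i \<Rightarrow> 'a set) \<Rightarrow> enat" where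
  "s_multiplicity s X I B =
     Inf {enat n | n::nat. \<forall>A\<subseteq>X. diam_at_most A s \<longrightarrow>
            finite {i\<in>I. B i \<inter> A \<noteq> {}} \<and> card {i\<in>I. B i \<inter> A \<noteq> {}} \<le> n}"

definition covering_of :: "'a set \<Rightarrow> 'i set \<Rightarrow> ('i \<Rightarrow> 'a set) \<Rightarrow> bool" where
  "covering_of X I B \<longleftrightarrow> (\<forall>i\<in>I. B i \<subseteq> X) \<and> (\<Union>i\<in>I. B i) = X"

text \<open>Here \<open>X\<close> is a subset of the ambient type, with the induced metric.
  HOL cannot quantify over index types inside a definition, so coverings are indexed by sets
  of sets. This loses no generality: replacing a family by its range, indexed by itself, keeps it
  a bounded covering and does not increase its multiplicity. The infimum ranges over all
  integers; the empty space has dimension -1.\<close>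

definition nagata_dim :: "'a::metric_space set \<Rightarrow> ereal" where
  "nagata_dim X =
     Inf {ereal (of_int n) | n::int. \<exists>c>0. \<forall>s>0. \<exists>(I :: 'a set set) (B :: 'a set \<Rightarrow> 'a set).
            covering_of X I B \<and> bounded_family (c * s) I B \<and>
            ereal_of_enat (s_multiplicity s X I B) \<le> ereal (of_int (n + 1))}"


section \<open>Lipschitz connectedness\<close>

text \<open>The smallest Lipschitz constant; used only for Lipschitz maps.\<close>

definition Lip :: "'a metric \<Rightarrow> 'b metric \<Rightarrow> ('a \<Rightarrow> 'b) \<Rightarrow> real" where
  "Lip M N f = Inf {L. 0 \<le> L \<and>
     (\<forall>x\<in>mspace M. \<forall>y\<in>mspace M. mdist N (f x) (f y) \<le> L * mdist M x y)}"

text \<open>Euclidean \<open>k\<close>-space for a variable \<open>k\<close>: sequences supported on \<open>{..<k}\<close>.\<close>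

definition Rn_metric :: "nat \<Rightarrow> (nat \<Rightarrow> real) metric" where
  "Rn_metric k = metric ({x. \<forall>i\<ge>k. x i = 0}, \<lambda>x y. L2_set (\<lambda>i. x i - y i) {..<k})"

lemma Metric_space_Rn:
  fixes k :: nat
  shows "Metric_space {x :: nat \<Rightarrow> real. \<forall>i\<ge>k. x i = 0} (\<lambda>x y. L2_set (\<lambda>i. x i - y i) {..<k})"
proof
  fix x y :: "nat \<Rightarrow> real"
  show "0 \<le> L2_set (\<lambda>i. x i - y i) {..<k}"
    by simp
  show "L2_set (\<lambda>i. x i - y i) {..<k} = L2_set (\<lambda>i. y i - x i) {..<k}"
    by (simp add: L2_set_def power2_commute)
next
  fix x y :: "nat \<Rightarrow> real"
  assume "x \<in> {x. \<forall>i\<ge>k. x i = 0}" "y \<in> {x. \<forall>i\<ge>k. x i = 0}"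
  then show "L2_set (\<lambda>i. x i - y i) {..<k} = 0 \<longleftrightarrow> x = y"
    by (auto simp: L2_set_eq_0_iff fun_eq_iff) (metis leI lessThan_iff)
next
  fix x y z :: "nat \<Rightarrow> real"
  show "L2_set (\<lambda>i. x i - z i) {..<k}
        \<le> L2_set (\<lambda>i. x i - y i) {..<k} + L2_set (\<lambda>i. y i - z i) {..<k}"
    using L2_set_triangle_ineq[of "\<lambda>i. x i - y i" "\<lambda>i. y i - z i" "{..<k}"] by simp
qed

lemma mspace_Rn_metric [simp]: "mspace (Rn_metric k) = {x. \<forall>i\<ge>k. x i = 0}"
  unfolding Rn_metric_def by (rule Metric_space.mspace_metric[OF Metric_space_Rn])

lemma mdist_Rn_metric [simp]:
  "mdist (Rn_metric k) = (\<lambda>x y. L2_set (\<lambda>i. x i - y i) {..<k})"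
  unfolding Rn_metric_def by (rule Metric_space.mdist_metric[OF Metric_space_Rn])

definition unit_sphere :: "nat \<Rightarrow> (nat \<Rightarrow> real) metric" where
  "unit_sphere m =
     submetric (Rn_metric (Suc m)) {x. mdist (Rn_metric (Suc m)) (\<lambda>_. 0) x = 1}"

text \<open>Indexed by its dimension: \<open>unit_ball k\<close> is the closed unit ball of Euclidean \<open>k\<close>-space,
  so \<open>unit_sphere m\<close> is the boundary of \<open>unit_ball (Suc m)\<close>.\<close>

definition unit_ball :: "nat \<Rightarrow> (nat \<Rightarrow> real) metric" where
  "unit_ball k = submetric (Rn_metric k) {x. mdist (Rn_metric k) (\<lambda>_. 0) x \<le> 1}"

definition Lipschitz_connected :: "nat \<Rightarrow> 'b metric \<Rightarrow> bool" where
  "Lipschitz_connected m Y \<longleftrightarrow>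
     (\<exists>c::real. \<forall>f. Lipschitz_continuous_map (unit_sphere m) Y f \<longrightarrow>
        (\<exists>g. Lipschitz_continuous_map (unit_ball (Suc m)) Y g \<and>
             (\<forall>x\<in>mspace (unit_sphere m). g x = f x) \<and>
             Lip (unit_ball (Suc m)) Y g \<le> c * Lip (unit_sphere m) Y f))"

end

theory Submission
  imports Defs
begin

text \<open>
  Off \<open>Z\<close> the values of the extension need only be controlled at the scale of
  the distance \<open>\<delta> x\<close> to \<open>Z\<close>: if the extension is Lipschitz on balls of radius proportional to
  \<open>\<delta> x\<close>, and its value at \<open>x\<close> is within a multiple of \<open>\<delta> x\<close> of the value of \<open>f\<close> at a point of \<open>Z\<close>
  near \<open>x\<close>, then it is Lipschitz (\<open>lipschitz_from_whitney_scale\<close>). Such an extension is obtained by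
  mapping the complement of \<open>Z\<close> to a simplicial complex of dimension at most \<open>n + 1\<close> whose vertices
  are labelled by points of \<open>Z\<close>, and mapping that complex to \<open>Y\<close>.

  The map from the complex to \<open>Y\<close> sends each vertex to the value of \<open>f\<close> at its label and is then
  extended over simplices of increasing dimension. A map on the boundary of an \<open>(m + 1)\<close>-simplex
  is a map on a sphere of dimension \<open>m\<close> up to a bi-Lipschitz change of coordinates, so Lipschitz
  \<open>m\<close>-connectedness fills it in, with a Lipschitz constant proportional to the diameter of the set of
  vertex values (\<open>skeleton_extension\<close>). Filling up to dimension \<open>n + 1\<close> uses precisely
  \<open>m = 0, \<dots>, n\<close>.

  The map to the complex comes from the coverings of \<open>Z\<close> that Nagata dimension provides at the scales
  \<open>r\<^sup>k\<close>. Slightly thickened, the covering at one scale has an at most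
  \<open>n\<close>-dimensional nerve. When \<open>r\<close> is large, sending
  a member at scale \<open>k\<close> to a member at scale \<open>k + 1\<close> that contains its base point is a simplicial
  map of nerves. The complex in question is the mapping telescope of these maps, and \<open>x\<close> moves along the
  telescope as \<open>\<delta> x\<close> grows. Going from scale \<open>k\<close> to scale \<open>k + 1\<close> has two phases. First, the point moves
  across the prism over its simplex in the nerve at scale \<open>k\<close>; in the standard triangulation of a prism
  with ordered vertices \<open>v\<^sub>0 < \<dots> < v\<^sub>p\<close> each point lies in a simplex with bottom vertices \<open>v\<^sub>0, \<dots>, v\<^sub>q\<close>
  and top vertices \<open>v\<^sub>q, \<dots>, v\<^sub>p\<close>, so that only one vertex is doubled and the dimension rises by one only.
  Second, the image point is moved linearly to the point given by the covering at scale \<open>k + 1\<close>,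
  inside one simplex of the nerve at that scale (locale \<open>scaled_covers\<close>).

  Two nearby points may still lie in different simplices of the telescope. This is repaired by
  subtracting a small constant from all weights and renormalizing: the weights that survive at
  \<open>y\<close> are positive at every point \<open>x\<close> close to \<open>y\<close>, so both images lie in the simplex that
  carries the unmodified weights of \<open>x\<close> (\<open>truncate_normalize_lipschitz\<close>).
\<close>

section \<open>Lipschitz connectedness as a filling property\<close>

text \<open>Both least Lipschitz constants are eliminated: they may be replaced by any bound on the sphere and
  by the resulting bound on the ball. The constant in the definition may be negative, so its absolute
  value is the one that serves all bounds.\<close>
lemma lipschitz_connected_filling:
  assumes "Lipschitz_connected m (euclidean_metric :: 'b::metric_space metric)"
  obtains C where "0 \<le> C"
    and "\<And>(f :: (nat \<Rightarrow> real) \<Rightarrow> 'b) L. 0 \<le> L \<Longrightarrow>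
        (\<And>x y. x \<in> mspace (unit_sphere m) \<Longrightarrow> y \<in> mspace (unit_sphere m) \<Longrightarrow>
           dist (f x) (f y) \<le> L * L2_set (\<lambda>i. x i - y i) {..<Suc m}) \<Longrightarrow>
        \<exists>g. (\<forall>x\<in>mspace (unit_sphere m). g x = f x) \<and>
          (\<forall>x\<in>mspace (unit_ball (Suc m)). \<forall>y\<in>mspace (unit_ball (Suc m)).
             dist (g x) (g y) \<le> C * L * L2_set (\<lambda>i. x i - y i) {..<Suc m})"
proof -
  let ?S = "unit_sphere m" and ?B = "unit_ball (Suc m)"
  let ?Y = "euclidean_metric :: 'b metric"
  from assms obtain c where c: "\<And>f. Lipschitz_continuous_map ?S ?Y f \<Longrightarrow>
        (\<exists>g. Lipschitz_continuous_map ?B ?Y g \<and> (\<forall>x\<in>mspace ?S. g x = f x) \<and>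
             Lip ?B ?Y g \<le> c * Lip ?S ?Y f)"
    unfolding Lipschitz_connected_def by blast
  have mS: "mdist ?S x y = L2_set (\<lambda>i. x i - y i) {..<Suc m}" for x y
    by (simp add: unit_sphere_def mdist_submetric)
  have mB: "mdist ?B x y = L2_set (\<lambda>i. x i - y i) {..<Suc m}" for x y
    by (simp add: unit_ball_def mdist_submetric)
  have "\<exists>g. (\<forall>x\<in>mspace ?S. g x = f x) \<and>
          (\<forall>x\<in>mspace ?B. \<forall>y\<in>mspace ?B.
             dist (g x) (g y) \<le> \<bar>c\<bar> * L * L2_set (\<lambda>i. x i - y i) {..<Suc m})"
    if "0 \<le> L" and f: "\<And>x y. x \<in> mspace ?S \<Longrightarrow> y \<in> mspace ?S \<Longrightarrow>
        dist (f x) (f y) \<le> L * L2_set (\<lambda>i. x i - y i) {..<Suc m}"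
    for f :: "(nat \<Rightarrow> real) \<Rightarrow> 'b" and L
  proof -
    have lf: "Lipschitz_continuous_map ?S ?Y f"
      unfolding Lipschitz_continuous_map_def using f by (auto simp: mS)
    from c[OF lf] obtain g where g: "Lipschitz_continuous_map ?B ?Y g"
      and ext: "\<forall>x\<in>mspace ?S. g x = f x" and gf: "Lip ?B ?Y g \<le> c * Lip ?S ?Y f" by blast
    let ?A = "\<lambda>(M :: (nat \<Rightarrow> real) metric) h. {L. 0 \<le> L \<and> (\<forall>x\<in>mspace M. \<forall>y\<in>mspace M. mdist ?Y (h x) (h y) \<le> L * mdist M x y)}"
    have Lf0: "0 \<le> Lip ?S ?Y f" and LfL: "Lip ?S ?Y f \<le> L"
    proof -
      have "L \<in> ?A ?S f" using that by (auto simp: mS)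
      then show "0 \<le> Lip ?S ?Y f" unfolding Lip_def by (intro cInf_greatest) auto
      from \<open>L \<in> ?A ?S f\<close> show "Lip ?S ?Y f \<le> L" unfolding Lip_def
        by (intro cInf_lower bdd_belowI[of _ 0]) auto
    qed
    from g obtain b where b: "\<And>x y. x \<in> mspace ?B \<Longrightarrow> y \<in> mspace ?B \<Longrightarrow> mdist ?Y (g x) (g y) \<le> b * mdist ?B x y"
      unfolding Lipschitz_continuous_map_def by auto
    have ne: "?A ?B g \<noteq> {}"
    proof -
      have "\<bar>b\<bar> \<in> ?A ?B g"
        using order.trans[OF b mult_right_mono[OF abs_ge_self mdist_nonneg]] by auto
      then show ?thesis by blast
    qed
    have "dist (g x) (g y) \<le> \<bar>c\<bar> * L * L2_set (\<lambda>i. x i - y i) {..<Suc m}"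
      if x: "x \<in> mspace ?B" and y: "y \<in> mspace ?B" for x y
    proof -
      let ?d = "mdist ?B x y"
      have "dist (g x) (g y) \<le> Lip ?B ?Y g * ?d"
      proof (cases "?d = 0")
        case True
        then show ?thesis using b[OF x y] by simp
      next
        case False
        then have "0 < ?d" by (metis mdist_nonneg order_less_le)
        then have "dist (g x) (g y) / ?d \<le> Lip ?B ?Y g"
          unfolding Lip_def using ne x y
          by (intro cInf_greatest) (auto simp: field_simps)
        then show ?thesis using \<open>0 < ?d\<close> by (simp add: field_simps)
      qed
      also have "\<dots> \<le> (\<bar>c\<bar> * L) * ?d"
      proof (rule mult_right_mono)
        have "c * Lip ?S ?Y f \<le> \<bar>c\<bar> * Lip ?S ?Y f" using Lf0 by (intro mult_right_mono) auto
        also have "\<dots> \<le> \<bar>c\<bar> * L" using LfL by (intro mult_left_mono) auto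
        finally show "Lip ?B ?Y g \<le> \<bar>c\<bar> * L" using gf by simp
      qed simp
      finally show ?thesis by (simp add: mB)
    qed
    with ext show ?thesis by blast
  qed
  then show ?thesis using that[of "\<bar>c\<bar>"] by simp
qed

lemma mspace_unit_sphere:
  "mspace (unit_sphere m) = {x. (\<forall>i\<ge>Suc m. x i = 0) \<and> L2_set x {..<Suc m} = 1}"
proof -
  have "L2_set (\<lambda>i. 0 - x i) {..<Suc m} = L2_set x {..<Suc m}" for x :: "nat \<Rightarrow> real"
    by (simp add: L2_set_def)
  then show ?thesis by (auto simp: unit_sphere_def)
qed

lemma mspace_unit_ball:
  "mspace (unit_ball k) = {x. (\<forall>i\<ge>k. x i = 0) \<and> L2_set x {..<k} \<le> 1}"
proof -
  have "L2_set (\<lambda>i. 0 - x i) {..<k} = L2_set x {..<k}" for x :: "nat \<Rightarrow> real"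
    by (simp add: L2_set_def)
  then show ?thesis by (auto simp: unit_ball_def)
qed

section \<open>Filling a simplex along its boundary\<close>

lemma Min_image_diff_le:
  fixes u v :: "'i \<Rightarrow> real"
  assumes "finite J" "J \<noteq> {}" "\<And>i. i \<in> J \<Longrightarrow> \<bar>u i - v i\<bar> \<le> d"
  shows "\<bar>Min (u ` J) - Min (v ` J)\<bar> \<le> d"
proof -
  have *: "Min (u ` J) \<le> Min (v ` J) + d"
    if uv: "\<And>i. i \<in> J \<Longrightarrow> \<bar>u i - v i\<bar> \<le> d" for u v :: "'i \<Rightarrow> real"
  proof -
    have "Min (v ` J) \<in> v ` J" using assms by simp
    then obtain i where "i \<in> J" "Min (v ` J) = v i" by auto
    moreover have "Min (u ` J) \<le> u i" using assms \<open>i \<in> J\<close> by simp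
    ultimately show ?thesis using uv[of i] by linarith
  qed
  from *[of u v] *[of v u] assms(3) show ?thesis by (fastforce simp: abs_minus_commute)
qed

definition std_simplex :: "'i set \<Rightarrow> ('i \<Rightarrow> real) set" where
  "std_simplex J = {u. (\<forall>i. 0 \<le> u i) \<and> (\<forall>i. i \<notin> J \<longrightarrow> u i = 0) \<and> sum u J = 1}"

definition simplex_boundary :: "'i set \<Rightarrow> ('i \<Rightarrow> real) set" where
  "simplex_boundary J = {u \<in> std_simplex J. \<exists>i\<in>J. u i = 0}"

definition l1_dist :: "'i set \<Rightarrow> ('i \<Rightarrow> real) \<Rightarrow> ('i \<Rightarrow> real) \<Rightarrow> real" where
  "l1_dist J u v = (\<Sum>i\<in>J. \<bar>u i - v i\<bar>)"

lemma L2_set_scale: "L2_set (\<lambda>i. c * v i) A = \<bar>c\<bar> * L2_set v A"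
  by (simp add: L2_set_def power_mult_distrib real_sqrt_mult flip: sum_distrib_left)

lemma L2_set_diff_le: "\<bar>L2_set v A - L2_set w A\<bar> \<le> L2_set (\<lambda>i. v i - w i) A"
proof -
  have "L2_set v A \<le> L2_set w A + L2_set (\<lambda>i. v i - w i) A"
    using L2_set_triangle_ineq[of w "\<lambda>i. v i - w i" A] by simp
  moreover have "L2_set w A \<le> L2_set v A + L2_set (\<lambda>i. v i - w i) A"
    using L2_set_triangle_ineq[of v "\<lambda>i. w i - v i" A]
    by (simp add: L2_set_def power2_commute)
  ultimately show ?thesis by linarith
qed

text \<open>A map that is radial in direction and has a Lipschitz length \<open>a\<close> is Lipschitz as soon as
  \<open>a\<close> is bounded by a multiple of the norm: the unit directions of \<open>v\<close> and \<open>w\<close> may differ much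
  near the origin, but the factor \<open>a\<close> compensates exactly there. At the origin itself \<open>a\<close> vanishes,
  which agrees with division by zero.\<close>
lemma radial_rescaling_lipschitz:
  fixes v w :: "'i \<Rightarrow> real"
  assumes "0 \<le> a" "0 \<le> b" "a \<le> C * L2_set v A" "b \<le> C * L2_set w A"
    and "\<bar>a - b\<bar> \<le> D" "L2_set (\<lambda>i. v i - w i) A \<le> D'" "0 \<le> C"
  shows "L2_set (\<lambda>i. a / L2_set v A * v i - b / L2_set w A * w i) A \<le> D + 2 * C * D'"
proof -
  let ?n = "L2_set v A" and ?n' = "L2_set w A"
  have D': "0 \<le> D'" using assms(6) L2_set_nonneg order.trans by blast
  have D: "0 \<le> D" using assms(5) by linarith
  consider "?n = 0" | "?n' = 0" | "?n > 0" "?n' > 0"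
    using L2_set_nonneg[of v A] L2_set_nonneg[of w A] by linarith
  then show ?thesis
  proof cases
    case 1
    then have "a = 0" using assms by simp
    have "L2_set (\<lambda>i. a / ?n * v i - b / ?n' * w i) A = L2_set (\<lambda>i. (- b / ?n') * w i) A"
      using \<open>a = 0\<close> by simp
    also have "\<dots> \<le> b" unfolding L2_set_scale using assms by (simp add: abs_mult)
    also have "\<dots> \<le> D" using assms \<open>a = 0\<close> by simp
    finally show ?thesis using assms(7) D' by (simp add: add_increasing2)
  next
    case 2
    then have "b = 0" using assms by simp
    have "L2_set (\<lambda>i. a / ?n * v i - b / ?n' * w i) A = L2_set (\<lambda>i. (a / ?n) * v i) A"
      using \<open>b = 0\<close> by simp
    also have "\<dots> \<le> a" unfolding L2_set_scale using assms by (simp add: abs_mult)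
    also have "\<dots> \<le> D" using assms \<open>b = 0\<close> by simp
    finally show ?thesis using assms(7) D' by (simp add: add_increasing2)
  next
    case 3
    have eq: "a / ?n * v i - b / ?n' * w i =
        ((a - b) / ?n) * v i + (b / ?n' * (v i - w i) + (b * (1 / ?n - 1 / ?n')) * v i)" for i
      by (simp add: algebra_simps diff_divide_distrib)
    have "L2_set (\<lambda>i. a / ?n * v i - b / ?n' * w i) A \<le>
       L2_set (\<lambda>i. ((a - b) / ?n) * v i) A +
       (L2_set (\<lambda>i. b / ?n' * (v i - w i)) A + L2_set (\<lambda>i. (b * (1 / ?n - 1 / ?n')) * v i) A)"
      unfolding eq by (intro order.trans[OF L2_set_triangle_ineq] add_left_mono L2_set_triangle_ineq)
    also have "\<dots> = \<bar>a - b\<bar> + (b / ?n' * L2_set (\<lambda>i. v i - w i) A + b * \<bar>1 / ?n - 1 / ?n'\<bar> * ?n)"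
      unfolding L2_set_scale using 3 assms by (simp add: abs_mult)
    also have "\<bar>1 / ?n - 1 / ?n'\<bar> * ?n = \<bar>?n' - ?n\<bar> / ?n'"
    proof -
      have "\<bar>1 / ?n - 1 / ?n'\<bar> * ?n = \<bar>(1 / ?n - 1 / ?n') * ?n\<bar>" using 3 by (simp add: abs_mult)
      also have "(1 / ?n - 1 / ?n') * ?n = (?n' - ?n) / ?n'" using 3 by (simp add: field_simps)
      finally show ?thesis using 3 by simp
    qed
    then have "b * \<bar>1 / ?n - 1 / ?n'\<bar> * ?n = b / ?n' * \<bar>?n' - ?n\<bar>" by (simp add: mult.assoc)
    also have "\<bar>a - b\<bar> + (b / ?n' * L2_set (\<lambda>i. v i - w i) A + \<dots>) \<le> D + (C * D' + C * D')"
    proof (intro add_mono mult_mono)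
      show "b / ?n' \<le> C" using 3 assms by (simp add: field_simps)
      then show "b / ?n' \<le> C" .
      show "\<bar>?n' - ?n\<bar> \<le> D'" using L2_set_diff_le[of v A w] assms by linarith
    qed (use assms in auto)
    finally show ?thesis by simp
  qed
qed

text \<open>The radial homeomorphism of the standard \<open>k\<close>-simplex onto the unit ball: the barycentre is moved to
  the origin, the last coordinate is dropped, and each ray is rescaled by the Minkowski gauge
  \<open>1 - (k + 1) min u\<close> of the simplex about its barycentre, which is 1 exactly on the boundary.\<close>
definition simplex_to_ball :: "nat \<Rightarrow> (nat \<Rightarrow> real) \<Rightarrow> nat \<Rightarrow> real" where
  "simplex_to_ball k u l =
     (if l < k then (1 - real (Suc k) * Min (u ` {..k})) /
                    L2_set (\<lambda>j. u j - 1 / real (Suc k)) {..<k} * (u l - 1 / real (Suc k))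
      else 0)"

text \<open>Recovers the dropped barycentric coordinate, using that displacements from the barycentre
  have coordinate sum 0.\<close>
definition zero_sum_completion :: "nat \<Rightarrow> (nat \<Rightarrow> real) \<Rightarrow> nat \<Rightarrow> real" where
  "zero_sum_completion k w l = (if l < k then w l else - (\<Sum>j<k. w j))"

text \<open>The point where the ray from the barycentre in direction \<open>w\<close> leaves the simplex: the ray stops when
  its smallest coordinate reaches 0.\<close>
definition sphere_to_simplex :: "nat \<Rightarrow> (nat \<Rightarrow> real) \<Rightarrow> nat \<Rightarrow> real" where
  "sphere_to_simplex k w l =
     (if l \<le> k then (1 - zero_sum_completion k w l / Min (zero_sum_completion k w ` {..k})) / real (Suc k)
      else 0)"

lemma sum_zero_sum_completion: "(\<Sum>l\<le>k. zero_sum_completion k w l) = 0"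
proof -
  have "(\<Sum>l\<le>k. zero_sum_completion k w l) = (\<Sum>l<k. zero_sum_completion k w l) + zero_sum_completion k w k"
    by (simp add: lessThan_Suc_atMost[symmetric])
  also have "(\<Sum>l<k. zero_sum_completion k w l) = (\<Sum>l<k. w l)"
    by (intro sum.cong) (auto simp: zero_sum_completion_def)
  finally show ?thesis by (simp add: zero_sum_completion_def)
qed

lemma Min_simplex_nonneg: "u \<in> std_simplex {..k} \<Longrightarrow> 0 \<le> Min (u ` {..(k::nat)})"
  by (auto simp: std_simplex_def)

lemma Min_simplex_boundary: "u \<in> simplex_boundary {..k} \<Longrightarrow> Min (u ` {..(k::nat)}) = 0"
  by (intro Min_eqI) (force simp: std_simplex_def simplex_boundary_def)+

lemma gauge_nonneg:
  assumes "u \<in> std_simplex {..k}"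
  shows "0 \<le> 1 - real (Suc k) * Min (u ` {..k})"
proof -
  have "real (Suc k) * Min (u ` {..k}) = (\<Sum>i\<le>k. Min (u ` {..k}))" by simp
  also have "\<dots> \<le> (\<Sum>i\<le>k. u i)" by (intro sum_mono Min_le) auto
  also have "\<dots> = 1" using assms by (simp add: std_simplex_def)
  finally show ?thesis by simp
qed

lemma abs_coord_le_L2:
  assumes "l < k" shows "\<bar>v l\<bar> \<le> L2_set v {..<k::nat}"
proof -
  have "\<bar>v l\<bar> \<le> L2_set (\<lambda>i. \<bar>v i\<bar>) {..<k}"
    using assms by (intro member_le_L2_set) auto
  then show ?thesis by (simp add: L2_set_def)
qed

lemma abs_sum_le_L2: "\<bar>\<Sum>l<k. v l\<bar> \<le> real k * L2_set v {..<k}"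
proof -
  have "\<bar>\<Sum>l<k. v l\<bar> \<le> (\<Sum>l<k. \<bar>v l\<bar>)" by (rule sum_abs)
  also have "\<dots> \<le> of_nat (card {..<k}) * L2_set v {..<k}"
    by (intro sum_bounded_above abs_coord_le_L2) auto
  finally show ?thesis by simp
qed

lemma abs_zero_sum_completion_le:
  assumes "1 \<le> k" shows "\<bar>zero_sum_completion k w l\<bar> \<le> real k * L2_set w {..<k}"
proof (cases "l < k")
  case True
  have "\<bar>w l\<bar> \<le> 1 * L2_set w {..<k}" using abs_coord_le_L2[OF True] by simp
  also have "\<dots> \<le> real k * L2_set w {..<k}" using assms by (intro mult_right_mono) auto
  finally show ?thesis using True by (simp add: zero_sum_completion_def)
qed (use abs_sum_le_L2[of w k] in \<open>simp add: zero_sum_completion_def\<close>)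

lemma zero_sum_completion_diff:
  "zero_sum_completion k (\<lambda>i. w i - w' i) l = zero_sum_completion k w l - zero_sum_completion k w' l"
  by (simp add: zero_sum_completion_def sum_subtractf)

text \<open>The simplex contains a Euclidean ball about its barycentre, so its gauge is bounded by a multiple of
  the norm; this is the hypothesis of \<open>radial_rescaling_lipschitz\<close>.\<close>
lemma gauge_le_norm:
  assumes u: "u \<in> std_simplex {..k}" and k: "1 \<le> k"
  shows "1 - real (Suc k) * Min (u ` {..k})
         \<le> real (Suc k) * real k * L2_set (\<lambda>j. u j - 1 / real (Suc k)) {..<k}"
proof -
  let ?v = "\<lambda>j. u j - 1 / real (Suc k)"
  have "Min (u ` {..k}) \<in> u ` {..k}" by (intro Min_in) auto
  then obtain l where l: "Min (u ` {..k}) = u l" "l \<in> {..k}" by (rule imageE)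
  then have "l \<le> k" by simp
  have "(\<Sum>j\<le>k. u j) = 1" using u by (simp add: std_simplex_def)
  then have sv: "(\<Sum>j<k. u j) + u k = 1" by (simp add: lessThan_Suc_atMost[symmetric])
  have "zero_sum_completion k ?v l = u l - 1 / real (Suc k)"
  proof (cases "l < k")
    case False
    then have "l = k" using \<open>l \<le> k\<close> by simp
    have "(\<Sum>j<k. ?v j) = 1 - u k - real k / real (Suc k)" using sv by (simp add: sum_subtractf)
    then show ?thesis using \<open>l = k\<close> by (simp add: zero_sum_completion_def field_simps)
  qed (simp add: zero_sum_completion_def)
  then have "1 / real (Suc k) - u l \<le> real k * L2_set ?v {..<k}"
    using abs_zero_sum_completion_le[OF k, of ?v l] by linarith
  then have "real (Suc k) * (1 / real (Suc k) - u l) \<le> real (Suc k) * (real k * L2_set ?v {..<k})"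
    by (intro mult_left_mono) auto
  then show ?thesis using l by (simp add: right_diff_distrib)
qed

lemma L2_simplex_to_ball:
  "L2_set (simplex_to_ball k u) {..<k} =
     \<bar>(1 - real (Suc k) * Min (u ` {..k})) / L2_set (\<lambda>j. u j - 1 / real (Suc k)) {..<k}\<bar>
       * L2_set (\<lambda>j. u j - 1 / real (Suc k)) {..<k}"
  unfolding L2_set_scale[symmetric] by (intro L2_set_cong) (auto simp: simplex_to_ball_def)

lemma simplex_to_ball_in_ball:
  assumes "u \<in> std_simplex {..k}"
  shows "simplex_to_ball k u \<in> mspace (unit_ball k)"
proof -
  have "L2_set (simplex_to_ball k u) {..<k} \<le> \<bar>1 - real (Suc k) * Min (u ` {..k})\<bar>"
    unfolding L2_simplex_to_ball by (simp add: abs_mult)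
  also have "\<dots> \<le> 1" using gauge_nonneg[OF assms] Min_simplex_nonneg[OF assms] by simp
  finally show ?thesis unfolding mspace_unit_ball by (auto simp: simplex_to_ball_def)
qed

lemma simplex_boundary_norm_pos:
  assumes u: "u \<in> simplex_boundary {..k}" and k: "1 \<le> k"
  shows "0 < L2_set (\<lambda>j. u j - 1 / real (Suc k)) {..<k}"
proof -
  have "u \<in> std_simplex {..k}" using u by (simp add: simplex_boundary_def)
  from gauge_le_norm[OF this k] Min_simplex_boundary[OF u]
  have "1 \<le> real (Suc k) * real k * L2_set (\<lambda>j. u j - 1 / real (Suc k)) {..<k}" by simp
  then have "L2_set (\<lambda>j. u j - 1 / real (Suc k)) {..<k} \<noteq> 0" by auto
  then show ?thesis by (simp add: order_less_le)
qed

lemma simplex_to_ball_in_sphere: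
  assumes u: "u \<in> simplex_boundary {..Suc m}"
  shows "simplex_to_ball (Suc m) u \<in> mspace (unit_sphere m)"
proof -
  have "L2_set (simplex_to_ball (Suc m) u) {..<Suc m} = 1"
    unfolding L2_simplex_to_ball using simplex_boundary_norm_pos[OF u] Min_simplex_boundary[OF u] by simp
  then show ?thesis unfolding mspace_unit_sphere by (auto simp: simplex_to_ball_def)
qed

lemma simplex_to_ball_lipschitz:
  assumes u: "u \<in> std_simplex {..k}" and v: "v \<in> std_simplex {..k}" and k: "1 \<le> k"
  shows "L2_set (\<lambda>i. simplex_to_ball k u i - simplex_to_ball k v i) {..<k}
         \<le> (real (Suc k) + 2 * (real (Suc k) * real k)) * l1_dist {..k} u v"
proof -
  let ?g = "\<lambda>u. 1 - real (Suc k) * Min (u ` {..k})"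
  let ?c = "\<lambda>u j. u j - 1 / real (Suc k)"
  let ?n = "\<lambda>u. L2_set (?c u) {..<k}"
  have "L2_set (\<lambda>i. simplex_to_ball k u i - simplex_to_ball k v i) {..<k}
      = L2_set (\<lambda>i. ?g u / ?n u * ?c u i - ?g v / ?n v * ?c v i) {..<k}"
    by (intro L2_set_cong) (auto simp: simplex_to_ball_def)
  also have "\<dots> \<le> real (Suc k) * l1_dist {..k} u v + 2 * (real (Suc k) * real k) * l1_dist {..k} u v"
  proof (rule radial_rescaling_lipschitz)
    have "\<bar>u i - v i\<bar> \<le> l1_dist {..k} u v" if "i \<in> {..k}" for i
      unfolding l1_dist_def using that by (intro member_le_sum) auto
    then have "\<bar>Min (v ` {..k}) - Min (u ` {..k})\<bar> \<le> l1_dist {..k} u v"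
      by (intro Min_image_diff_le) (auto simp: abs_minus_commute)
    then have "real (Suc k) * \<bar>Min (v ` {..k}) - Min (u ` {..k})\<bar> \<le> real (Suc k) * l1_dist {..k} u v"
      by (intro mult_left_mono) auto
    moreover have "\<bar>?g u - ?g v\<bar> = real (Suc k) * \<bar>Min (v ` {..k}) - Min (u ` {..k})\<bar>"
    proof -
      have "?g u - ?g v = real (Suc k) * (Min (v ` {..k}) - Min (u ` {..k}))" by (simp add: right_diff_distrib)
      then show ?thesis by (simp add: abs_mult)
    qed
    ultimately show "\<bar>?g u - ?g v\<bar> \<le> real (Suc k) * l1_dist {..k} u v" by simp
    have "L2_set (\<lambda>i. ?c u i - ?c v i) {..<k} \<le> (\<Sum>i<k. \<bar>u i - v i\<bar>)"
      using L2_set_le_sum_abs[of "\<lambda>i. u i - v i" "{..<k}"] by simp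
    also have "\<dots> \<le> l1_dist {..k} u v" unfolding l1_dist_def by (intro sum_mono2) auto
    finally show "L2_set (\<lambda>i. ?c u i - ?c v i) {..<k} \<le> l1_dist {..k} u v" .
  qed (use gauge_nonneg[OF u] gauge_nonneg[OF v] gauge_le_norm[OF u k] gauge_le_norm[OF v k] in auto)
  finally show ?thesis by (simp add: distrib_right)
qed

text \<open>A unit vector has a coordinate of absolute value at least \<open>1 / k\<close>. If that coordinate is positive,
  the \<open>k\<close> other coordinates of its completion sum to at most \<open>- 1 / k\<close>, so one of them is at most
  \<open>- 1 / k\<^sup>2\<close>. This keeps the denominator in \<open>sphere_to_simplex\<close> away from 0.\<close>
lemma Min_zero_sum_completion_le:
  assumes w: "L2_set w {..<k} = 1" and k: "1 \<le> k"
  shows "Min (zero_sum_completion k w ` {..k}) \<le> - 1 / real k ^ 2"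
proof (rule ccontr)
  let ?z = "zero_sum_completion k w"
  assume "\<not> ?thesis"
  then have low: "- 1 / real k ^ 2 < ?z l" if "l \<le> k" for l
    using that by (subst (asm) not_le, subst (asm) Min_gr_iff) auto
  have up: "?z l < 1 / real k" if l: "l \<le> k" for l
  proof -
    have "0 = ?z l + (\<Sum>j\<in>{..k} - {l}. ?z j)"
      using sum_zero_sum_completion[of k w] l by (subst (asm) sum.remove[of _ l]) auto
    moreover have "(\<Sum>j\<in>{..k} - {l}. - 1 / real k ^ 2) < (\<Sum>j\<in>{..k} - {l}. ?z j)"
    proof (rule sum_strict_mono)
      have "card ({..k} - {l}) \<noteq> 0" using l k by simp
      then show "{..k} - {l} \<noteq> {}" by (metis card.empty)
    qed (use low in auto)
    moreover have "(\<Sum>j\<in>{..k} - {l}. - 1 / real k ^ 2) = - (1 / real k)"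
      using l k by (simp add: power2_eq_square field_simps)
    ultimately show ?thesis by linarith
  qed
  have "1 / real k ^ 2 \<le> 1 / real k" using k by (simp add: power2_eq_square field_simps)
  then have "\<bar>w l\<bar> < 1 / real k" if "l < k" for l
    using low[of l] up[of l] that by (auto simp: zero_sum_completion_def)
  then have "(\<Sum>l<k. \<bar>w l\<bar>) < (\<Sum>l<k. 1 / real k)" using k by (intro sum_strict_mono) (auto simp: lessThan_empty_iff)
  then show False using L2_set_le_sum_abs[of w "{..<k}"] w k by simp
qed

lemma sphere_to_simplex_in_boundary:
  assumes "w \<in> mspace (unit_sphere m)"
  shows "sphere_to_simplex (Suc m) w \<in> simplex_boundary {..Suc m}"
proof -
  define k where "k = Suc m"
  let ?z = "zero_sum_completion k w"
  let ?M = "Min (?z ` {..k})"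
  have "?M \<le> - 1 / real k ^ 2" using assms
    by (intro Min_zero_sum_completion_le) (auto simp: k_def mspace_unit_sphere)
  moreover have "- 1 / real k ^ 2 < 0" by (simp add: k_def)
  ultimately have M: "?M < 0" by linarith
  have ge0: "0 \<le> sphere_to_simplex k w l" for l
  proof (cases "l \<le> k")
    case True
    then have "?M \<le> ?z l" by simp
    then have "?z l / ?M \<le> 1" using M by (simp add: field_simps)
    then show ?thesis using True by (simp add: sphere_to_simplex_def)
  qed (simp add: sphere_to_simplex_def)
  have "(\<Sum>l\<le>k. sphere_to_simplex k w l) = (\<Sum>l\<le>k. (1 - ?z l / ?M)) / real (Suc k)"
    by (subst sum_divide_distrib) (auto intro!: sum.cong simp: sphere_to_simplex_def)
  also have "(\<Sum>l\<le>k. (1 - ?z l / ?M)) = real (Suc k)"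
    using sum_zero_sum_completion[of k w] by (simp add: sum_subtractf flip: sum_divide_distrib)
  finally have sum1: "(\<Sum>l\<le>k. sphere_to_simplex k w l) = 1" by simp
  have "?M \<in> ?z ` {..k}" by (intro Min_in) auto
  then obtain l where "?M = ?z l" "l \<in> {..k}" by (rule imageE)
  then have "l \<le> k" by simp
  with \<open>?M = ?z l\<close> have "sphere_to_simplex k w l = 0" using M by (simp add: sphere_to_simplex_def)
  then show ?thesis using ge0 sum1 \<open>l \<le> k\<close> unfolding k_def[symmetric]
    by (auto simp: simplex_boundary_def std_simplex_def sphere_to_simplex_def)
qed

lemma sphere_to_simplex_inverse:
  assumes u: "u \<in> simplex_boundary {..Suc m}"
  shows "sphere_to_simplex (Suc m) (simplex_to_ball (Suc m) u) = u"
proof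
  fix l
  define k where "k = Suc m"
  define c where "c = (\<lambda>j. u j - 1 / real (Suc k))"
  define n where "n = L2_set c {..<k}"
  let ?z = "zero_sum_completion k (simplex_to_ball k u)"
  have n: "0 < n" using simplex_boundary_norm_pos[OF u] by (simp add: n_def c_def k_def)
  have min0: "Min (u ` {..k}) = 0" using Min_simplex_boundary[OF u] by (simp add: k_def)
  have us: "u \<in> std_simplex {..k}" using u by (simp add: simplex_boundary_def k_def)
  then have "(\<Sum>j\<le>k. u j) = 1" by (simp add: std_simplex_def)
  then have sv: "(\<Sum>j<k. u j) + u k = 1" by (simp add: lessThan_Suc_atMost[symmetric])
  have z: "?z l = c l / n" if "l \<le> k" for l
  proof (cases "l < k")
    case True
    then show ?thesis by (simp add: zero_sum_completion_def simplex_to_ball_def min0 n_def c_def)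
  next
    case False
    then have "l = k" using that by simp
    have "(\<Sum>j<k. simplex_to_ball k u j) = (\<Sum>j<k. c j / n)"
      by (intro sum.cong) (auto simp: simplex_to_ball_def min0 n_def c_def)
    also have "\<dots> = (\<Sum>j<k. c j) / n" by (simp add: sum_divide_distrib)
    also have "(\<Sum>j<k. c j) = 1 - u k - real k / real (Suc k)" using sv by (simp add: c_def sum_subtractf)
    also have "\<dots> = - c k" by (simp add: c_def field_simps)
    finally show ?thesis using \<open>l = k\<close> by (simp add: zero_sum_completion_def)
  qed
  have minz: "Min (?z ` {..k}) = - (1 / real (Suc k)) / n"
  proof (rule Min_eqI)
    obtain i where i: "i \<le> k" "u i = 0" using u by (auto simp: simplex_boundary_def k_def)
    then show "- (1 / real (Suc k)) / n \<in> ?z ` {..k}" using z[of i] by (auto simp: c_def intro!: image_eqI[of _ _ i])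
    fix y assume "y \<in> ?z ` {..k}"
    then obtain j where y: "y = c j / n" using z by auto
    have "- (1 / real (Suc k)) \<le> c j" using us by (simp add: c_def std_simplex_def)
    then show "- (1 / real (Suc k)) / n \<le> y" unfolding y using n by (intro divide_right_mono) auto
  qed auto
  have "sphere_to_simplex k (simplex_to_ball k u) l = u l"
  proof (cases "l \<le> k")
    case True
    have "(1 - (a / n) / (- (1 / K) / n)) / K = 1 / K + a" if "0 < K" for a K :: real
      using that n by (simp add: field_simps)
    from this[of "real (Suc k)" "c l"] show ?thesis
      using True z[OF True] minz by (simp add: sphere_to_simplex_def c_def)
  qed (use us in \<open>simp add: sphere_to_simplex_def std_simplex_def\<close>)
  then show "sphere_to_simplex (Suc m) (simplex_to_ball (Suc m) u) l = u l" by (simp add: k_def)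
qed

lemma sphere_to_simplex_lipschitz:
  assumes w: "w \<in> mspace (unit_sphere m)" and w': "w' \<in> mspace (unit_sphere m)" and k: "k = Suc m"
  shows "l1_dist {..k} (sphere_to_simplex k w) (sphere_to_simplex k w')
         \<le> real k ^ 3 * (1 + real k ^ 3) * L2_set (\<lambda>i. w i - w' i) {..<k}"
proof -
  define D where "D = L2_set (\<lambda>i. w i - w' i) {..<k}"
  let ?z = "zero_sum_completion k w" and ?z' = "zero_sum_completion k w'"
  define s where "s = - Min (?z ` {..k})"
  define s' where "s' = - Min (?z' ` {..k})"
  have mins: "Min (?z ` {..k}) = - s" "Min (?z' ` {..k}) = - s'" unfolding s_def s'_def by linarith+
  have k1: "1 \<le> k" using k by simp
  have D: "0 \<le> D" by (simp add: D_def)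
  have "Min (?z ` {..k}) \<le> - 1 / real k ^ 2" "Min (?z' ` {..k}) \<le> - 1 / real k ^ 2"
    by (rule Min_zero_sum_completion_le; use w w' k in \<open>simp add: mspace_unit_sphere\<close>)+
  then have s_ge: "1 / real k ^ 2 \<le> s" "1 / real k ^ 2 \<le> s'"
    unfolding s_def s'_def by linarith+
  have k2: "0 < 1 / real k ^ 2" using k by simp
  have s0: "0 < s" "0 < s'" using s_ge k2 by linarith+
  have inv: "1 / s \<le> real k ^ 2" "1 / s' \<le> real k ^ 2"
    using s_ge s0 k by (auto simp: field_simps)
  have zd: "\<bar>?z l - ?z' l\<bar> \<le> real k * D" for l
    using abs_zero_sum_completion_le[OF k1, of "\<lambda>i. w i - w' i" l]
    by (simp add: zero_sum_completion_diff D_def)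
  have z'k: "\<bar>?z' l\<bar> \<le> real k" for l
    using abs_zero_sum_completion_le[OF k1, of w' l] w' k by (simp add: mspace_unit_sphere)
  have sd: "\<bar>s' - s\<bar> \<le> real k * D"
  proof -
    have "s' - s = Min (?z ` {..k}) - Min (?z' ` {..k})" unfolding s_def s'_def by linarith
    then show ?thesis using zd by (simp only:) (intro Min_image_diff_le, auto)
  qed
  have coord: "\<bar>?z l / s - ?z' l / s'\<bar> \<le> real k ^ 3 * (1 + real k ^ 3) * D" for l
  proof -
    have "?z l / s - ?z' l / s' = (?z l - ?z' l) * (1 / s) + ?z' l * ((s' - s) * ((1 / s) * (1 / s')))"
    proof -
      have "a / s - b / t = (a - b) * (1 / s) + b * ((t - s) * ((1 / s) * (1 / t)))"
        if "s > 0" "t > 0" for a b s t :: real using that by (simp add: field_simps)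
      then show ?thesis using s0 by blast
    qed
    also have "\<bar>\<dots>\<bar> \<le> \<bar>?z l - ?z' l\<bar> * (1 / s) + \<bar>?z' l\<bar> * (\<bar>s' - s\<bar> * ((1 / s) * (1 / s')))"
      using s0 by (intro order.trans[OF abs_triangle_ineq]) (simp add: abs_mult)
    also have "\<dots> \<le> (real k * D) * real k ^ 2 + real k * ((real k * D) * (real k ^ 2 * real k ^ 2))"
      using s0 D by (intro add_mono mult_mono zd z'k sd inv) auto
    also have "\<dots> = real k ^ 3 * (1 + real k ^ 3) * D" by (simp add: algebra_simps power_def numeral_eq_Suc)
    finally show ?thesis .
  qed
  have "\<bar>sphere_to_simplex k w l - sphere_to_simplex k w' l\<bar> = \<bar>?z l / s - ?z' l / s'\<bar> / real (Suc k)"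
    if "l \<le> k" for l
  proof -
    have "sphere_to_simplex k w l - sphere_to_simplex k w' l = (?z l / s - ?z' l / s') / real (Suc k)"
      using that by (simp add: sphere_to_simplex_def diff_divide_distrib add_divide_distrib mins)
    then show ?thesis by (simp add: abs_divide)
  qed
  then have "l1_dist {..k} (sphere_to_simplex k w) (sphere_to_simplex k w')
      = (\<Sum>l\<le>k. \<bar>?z l / s - ?z' l / s'\<bar> / real (Suc k))"
    unfolding l1_dist_def by (intro sum.cong) auto
  also have "\<dots> \<le> of_nat (card {..k}) * (real k ^ 3 * (1 + real k ^ 3) * D / real (Suc k))"
    by (intro sum_bounded_above divide_right_mono coord) auto
  also have "\<dots> = real k ^ 3 * (1 + real k ^ 3) * D" by simp
  finally show ?thesis by (simp add: D_def)
qed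

text \<open>A boundary map is pulled back to the sphere, filled there, and the filling is pulled back
  along \<open>simplex_to_ball\<close>; the two radial maps are mutually inverse on the boundary, so the result
  extends the given map.\<close>
lemma simplex_filling_atMost:
  assumes "Lipschitz_connected m (euclidean_metric :: 'b::metric_space metric)"
  obtains C where "0 \<le> C"
    and "\<And>(h :: (nat \<Rightarrow> real) \<Rightarrow> 'b) L. 0 \<le> L \<Longrightarrow>
        (\<And>u v. u \<in> simplex_boundary {..Suc m} \<Longrightarrow> v \<in> simplex_boundary {..Suc m} \<Longrightarrow>
           dist (h u) (h v) \<le> L * l1_dist {..Suc m} u v) \<Longrightarrow>
        \<exists>g. (\<forall>u\<in>simplex_boundary {..Suc m}. g u = h u) \<and>
          (\<forall>u\<in>std_simplex {..Suc m}. \<forall>v\<in>std_simplex {..Suc m}.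
             dist (g u) (g v) \<le> C * L * l1_dist {..Suc m} u v)"
proof -
  let ?k = "Suc m"
  define K1 where "K1 = real ?k ^ 3 * (1 + real ?k ^ 3)"
  define K2 where "K2 = real (Suc ?k) + 2 * (real (Suc ?k) * real ?k)"
  have K: "0 \<le> K1" "0 \<le> K2" by (simp_all add: K1_def K2_def)
  obtain C where C: "0 \<le> C"
    and fill: "\<And>(f :: (nat \<Rightarrow> real) \<Rightarrow> 'b) L. 0 \<le> L \<Longrightarrow>
        (\<And>x y. x \<in> mspace (unit_sphere m) \<Longrightarrow> y \<in> mspace (unit_sphere m) \<Longrightarrow>
           dist (f x) (f y) \<le> L * L2_set (\<lambda>i. x i - y i) {..<?k}) \<Longrightarrow>
        \<exists>g. (\<forall>x\<in>mspace (unit_sphere m). g x = f x) \<and>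
          (\<forall>x\<in>mspace (unit_ball ?k). \<forall>y\<in>mspace (unit_ball ?k).
             dist (g x) (g y) \<le> C * L * L2_set (\<lambda>i. x i - y i) {..<?k})"
    by (rule lipschitz_connected_filling[OF assms]) blast
  show ?thesis
  proof (rule that[of "C * K1 * K2"])
    fix h :: "(nat \<Rightarrow> real) \<Rightarrow> 'b" and L
    assume L: "0 \<le> (L::real)" and h: "\<And>u v. u \<in> simplex_boundary {..?k} \<Longrightarrow> v \<in> simplex_boundary {..?k} \<Longrightarrow>
           dist (h u) (h v) \<le> L * l1_dist {..?k} u v"
    have "dist (h (sphere_to_simplex ?k x)) (h (sphere_to_simplex ?k y))
          \<le> L * K1 * L2_set (\<lambda>i. x i - y i) {..<?k}"
      if x: "x \<in> mspace (unit_sphere m)" and y: "y \<in> mspace (unit_sphere m)" for x y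
    proof -
      have "dist (h (sphere_to_simplex ?k x)) (h (sphere_to_simplex ?k y))
          \<le> L * l1_dist {..?k} (sphere_to_simplex ?k x) (sphere_to_simplex ?k y)"
        by (intro h sphere_to_simplex_in_boundary x y)
      also have "\<dots> \<le> L * (K1 * L2_set (\<lambda>i. x i - y i) {..<?k})"
        unfolding K1_def by (intro mult_left_mono sphere_to_simplex_lipschitz[where m = m] x y L refl)
      finally show ?thesis by (simp add: mult.assoc)
    qed
    from fill[OF mult_nonneg_nonneg[OF L K(1)] this] obtain G where
      G: "\<forall>x\<in>mspace (unit_sphere m). G x = h (sphere_to_simplex ?k x)"
      and GL: "\<forall>x\<in>mspace (unit_ball ?k). \<forall>y\<in>mspace (unit_ball ?k).
             dist (G x) (G y) \<le> C * (L * K1) * L2_set (\<lambda>i. x i - y i) {..<?k}"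
      by blast
    show "\<exists>g. (\<forall>u\<in>simplex_boundary {..?k}. g u = h u) \<and>
          (\<forall>u\<in>std_simplex {..?k}. \<forall>v\<in>std_simplex {..?k}.
             dist (g u) (g v) \<le> C * K1 * K2 * L * l1_dist {..?k} u v)"
    proof (intro exI[of _ "\<lambda>u. G (simplex_to_ball ?k u)"] conjI ballI)
      fix u assume "u \<in> simplex_boundary {..?k}"
      then show "G (simplex_to_ball ?k u) = h u"
        by (simp add: G simplex_to_ball_in_sphere sphere_to_simplex_inverse)
    next
      fix u v assume u: "u \<in> std_simplex {..?k}" and v: "v \<in> std_simplex {..?k}"
      have "dist (G (simplex_to_ball ?k u)) (G (simplex_to_ball ?k v))
        \<le> C * (L * K1) * L2_set (\<lambda>i. simplex_to_ball ?k u i - simplex_to_ball ?k v i) {..<?k}"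
        by (intro GL[rule_format] simplex_to_ball_in_ball u v)
      also have "\<dots> \<le> C * (L * K1) * (K2 * l1_dist {..?k} u v)"
        unfolding K2_def using C L K by (intro mult_left_mono simplex_to_ball_lipschitz u v) auto
      finally show "dist (G (simplex_to_ball ?k u)) (G (simplex_to_ball ?k v))
          \<le> C * K1 * K2 * L * l1_dist {..?k} u v" by (simp add: mult_ac)
    qed
  qed (use C K in auto)
qed

text \<open>The simplex on an arbitrary vertex set is the standard one after an enumeration of its vertices,
  which preserves \<open>l1_dist\<close>; so one constant serves all simplices of a given dimension.\<close>
lemma simplex_filling:
  assumes "Lipschitz_connected m (euclidean_metric :: 'b::metric_space metric)"
  obtains C where "0 \<le> C"
    and "\<And>(J :: 'i set) (h :: ('i \<Rightarrow> real) \<Rightarrow> 'b) L. finite J \<Longrightarrow> card J = Suc (Suc m) \<Longrightarrow> 0 \<le> L \<Longrightarrow>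
        (\<And>u v. u \<in> simplex_boundary J \<Longrightarrow> v \<in> simplex_boundary J \<Longrightarrow>
           dist (h u) (h v) \<le> L * l1_dist J u v) \<Longrightarrow>
        \<exists>g. (\<forall>u\<in>simplex_boundary J. g u = h u) \<and>
          (\<forall>u\<in>std_simplex J. \<forall>v\<in>std_simplex J.
             dist (g u) (g v) \<le> C * L * l1_dist J u v)"
proof -
  let ?N = "{..Suc m}"
  obtain C where C: "0 \<le> C"
    and fill: "\<And>(h :: (nat \<Rightarrow> real) \<Rightarrow> 'b) L. 0 \<le> L \<Longrightarrow>
        (\<And>u v. u \<in> simplex_boundary ?N \<Longrightarrow> v \<in> simplex_boundary ?N \<Longrightarrow>
           dist (h u) (h v) \<le> L * l1_dist ?N u v) \<Longrightarrow>
        \<exists>g. (\<forall>u\<in>simplex_boundary ?N. g u = h u) \<and>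
          (\<forall>u\<in>std_simplex ?N. \<forall>v\<in>std_simplex ?N.
             dist (g u) (g v) \<le> C * L * l1_dist ?N u v)"
    by (rule simplex_filling_atMost[OF assms]) blast
  show ?thesis
  proof (rule that[OF C])
    fix J :: "'i set" and h :: "('i \<Rightarrow> real) \<Rightarrow> 'b" and L
    assume J: "finite J" "card J = Suc (Suc m)" and L: "0 \<le> L"
      and h: "\<And>u v. u \<in> simplex_boundary J \<Longrightarrow> v \<in> simplex_boundary J \<Longrightarrow>
           dist (h u) (h v) \<le> L * l1_dist J u v"
    have "card ?N = card J" using J by simp
    then obtain e where e: "bij_betw e ?N J" using J finite_same_card_bij by blast
    define push where "push u i = (if i \<in> J then u (inv_into ?N e i) else 0)" for u :: "nat \<Rightarrow> real" and i
    define pull where "pull u l = (if l \<in> ?N then u (e l) else 0)" for u :: "'i \<Rightarrow> real" and l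
    have push_e: "push u (e l) = u l" if "l \<in> ?N" for u l
      using e that bij_betw_inv_into_left[OF e] by (simp add: push_def bij_betw_apply)
    have pull_push: "push (pull u) = u" if "\<And>i. i \<notin> J \<Longrightarrow> u i = 0" for u
    proof
      fix i show "push (pull u) i = u i"
      proof (cases "i \<in> J")
        case True
        then obtain l where "l \<in> ?N" "i = e l" using e by (auto simp: bij_betw_def)
        then show ?thesis using push_e[of l "pull u"] by (simp add: pull_def)
      qed (use that in \<open>simp add: push_def\<close>)
    qed
    have sumJ: "sum g J = (\<Sum>l\<in>?N. g (e l))" for g :: "'i \<Rightarrow> real"
      using sum.reindex_bij_betw[OF e, of g] by simp
    have push_s: "push u \<in> std_simplex J" if "u \<in> std_simplex ?N" for u
    proof -
      have "sum (push u) J = sum u ?N" unfolding sumJ by (intro sum.cong) (auto simp: push_e)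
      then show ?thesis using that by (auto simp: std_simplex_def push_def)
    qed
    have pull_s: "pull u \<in> std_simplex ?N" if "u \<in> std_simplex J" for u
    proof -
      have "sum (pull u) ?N = sum u J" unfolding sumJ by (intro sum.cong) (auto simp: pull_def)
      then show ?thesis using that by (auto simp: std_simplex_def pull_def)
    qed
    have push_b: "push u \<in> simplex_boundary J" if u: "u \<in> simplex_boundary ?N" for u
    proof -
      from u obtain l where "l \<in> ?N" "u l = 0" by (auto simp: simplex_boundary_def)
      then have "e l \<in> J" "push u (e l) = 0" using e push_e by (auto simp: bij_betw_def)
      then show ?thesis using push_s[of u] u unfolding simplex_boundary_def by blast
    qed
    have pull_b: "pull u \<in> simplex_boundary ?N" if u: "u \<in> simplex_boundary J" for u
    proof -
      from u obtain i where "i \<in> J" "u i = 0" by (auto simp: simplex_boundary_def)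
      then obtain l where "l \<in> ?N" "u (e l) = 0" using e by (auto simp: bij_betw_def)
      then have "pull u l = 0" by (simp add: pull_def)
      then show ?thesis using pull_s[of u] u \<open>l \<in> ?N\<close> unfolding simplex_boundary_def by blast
    qed
    have push_d: "l1_dist J (push u) (push v) = l1_dist ?N u v" for u v
      unfolding l1_dist_def sumJ by (intro sum.cong) (auto simp: push_e)
    have pull_d: "l1_dist ?N (pull u) (pull v) = l1_dist J u v" for u v
      unfolding l1_dist_def sumJ by (intro sum.cong) (auto simp: pull_def)
    have "\<exists>g. (\<forall>u\<in>simplex_boundary ?N. g u = h (push u)) \<and>
          (\<forall>u\<in>std_simplex ?N. \<forall>v\<in>std_simplex ?N.
             dist (g u) (g v) \<le> C * L * l1_dist ?N u v)"
      using h[OF push_b push_b] by (intro fill L) (simp add: push_d)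
    then obtain g where g: "\<And>u. u\<in>simplex_boundary ?N \<Longrightarrow> g u = h (push u)"
      "\<And>u v. u\<in>std_simplex ?N \<Longrightarrow> v\<in>std_simplex ?N \<Longrightarrow> dist (g u) (g v) \<le> C * L * l1_dist ?N u v"
      by blast
    show "\<exists>g. (\<forall>u\<in>simplex_boundary J. g u = h u) \<and>
          (\<forall>u\<in>std_simplex J. \<forall>v\<in>std_simplex J.
             dist (g u) (g v) \<le> C * L * l1_dist J u v)"
    proof (intro exI[of _ "\<lambda>u. g (pull u)"] conjI ballI)
      fix u assume u: "u \<in> simplex_boundary J"
      then have "push (pull u) = u" by (intro pull_push) (auto simp: simplex_boundary_def std_simplex_def)
      then show "g (pull u) = h u" using g(1)[OF pull_b[OF u]] by simp
    next
      fix u v assume "u \<in> std_simplex J" "v \<in> std_simplex J"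
      then show "dist (g (pull u)) (g (pull v)) \<le> C * L * l1_dist J u v"
        using g(2)[OF pull_s pull_s, of u v] by (simp add: pull_d)
    qed
  qed
qed

section \<open>Extension over a skeleton\<close>

lemma l1_dist_triangle: "l1_dist J u w \<le> l1_dist J u v + l1_dist J v w"
  unfolding l1_dist_def sum.distrib[symmetric] by (intro sum_mono) linarith

lemma l1_dist_commute: "l1_dist J u v = l1_dist J v u"
  unfolding l1_dist_def by (intro sum.cong) (auto simp: abs_minus_commute)

lemma l1_dist_mono: "finite J \<Longrightarrow> I \<subseteq> J \<Longrightarrow> l1_dist I u v \<le> l1_dist J u v"
  unfolding l1_dist_def by (intro sum_mono2) auto

lemma l1_dist_nonneg: "0 \<le> l1_dist J u v"
  unfolding l1_dist_def by (intro sum_nonneg) auto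

lemma std_simplex_face:
  assumes "finite J" "u \<in> std_simplex J" "I \<subseteq> J" "\<And>i. i \<in> J - I \<Longrightarrow> u i = 0"
  shows "u \<in> std_simplex I"
proof -
  have "sum u I = sum u J" using assms by (intro sum.mono_neutral_left) auto
  then show ?thesis using assms by (auto simp: std_simplex_def)
qed

text \<open>The boundary of a simplex with at least three vertices is quasiconvex: two points on different
  facets can be joined through a point \<open>z\<close> of the common subface at bounded extra cost. For \<open>u\<close> on
  the facet opposite \<open>i\<close> and \<open>v\<close> on the facet opposite \<open>j\<close>, the coordinate \<open>u j\<close> is at most the distance
  of \<open>u\<close> and \<open>v\<close>, because \<open>v j = 0\<close>; moving this mass to a third vertex gives \<open>z\<close>.\<close>
lemma boundary_lipschitz_from_facets:
  fixes F :: "('i \<Rightarrow> real) \<Rightarrow> 'b::metric_space"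
  assumes J: "finite J" "3 \<le> card J" and M: "0 \<le> M"
    and F: "\<And>i u v. i \<in> J \<Longrightarrow> u \<in> std_simplex (J - {i}) \<Longrightarrow> v \<in> std_simplex (J - {i}) \<Longrightarrow>
         dist (F u) (F v) \<le> M * l1_dist (J - {i}) u v"
    and u: "u \<in> simplex_boundary J" and v: "v \<in> simplex_boundary J"
  shows "dist (F u) (F v) \<le> 5 * M * l1_dist J u v"
proof -
  have F': "dist (F a) (F b) \<le> M * l1_dist J a b"
    if "i \<in> J" "a \<in> std_simplex J" "a i = 0" "b \<in> std_simplex J" "b i = 0" for i a b
  proof -
    have "dist (F a) (F b) \<le> M * l1_dist (J - {i}) a b"
    proof (rule F)
      show "a \<in> std_simplex (J - {i})" by (rule std_simplex_face[OF J(1) that(2)]) (use that in auto)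
      show "b \<in> std_simplex (J - {i})" by (rule std_simplex_face[OF J(1) that(4)]) (use that in auto)
    qed (use that in simp)
    also have "\<dots> \<le> M * l1_dist J a b" using M J by (intro mult_left_mono l1_dist_mono) auto
    finally show ?thesis .
  qed
  from u obtain i where us: "u \<in> std_simplex J" and i: "i \<in> J" "u i = 0" by (auto simp: simplex_boundary_def)
  from v obtain j where vs: "v \<in> std_simplex J" and j: "j \<in> J" "v j = 0" by (auto simp: simplex_boundary_def)
  show ?thesis
  proof (cases "i = j")
    case True
    then have "dist (F u) (F v) \<le> M * l1_dist J u v" using F' us vs i j by blast
    also have "\<dots> \<le> 5 * M * l1_dist J u v" using M l1_dist_nonneg[of J u v] by (simp add: mult_right_mono)
    finally show ?thesis .
  next
    case False
    have "\<not> J \<subseteq> {i, j}"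
    proof
      assume "J \<subseteq> {i, j}"
      then have "card J \<le> card {i, j}" by (intro card_mono) auto
      then show False using J False by simp
    qed
    then obtain l where l: "l \<in> J" "l \<noteq> i" "l \<noteq> j" by auto
    define z where "z = u(j := 0, l := u l + u j)"
    have split: "sum g J = g j + (g l + sum g (J - {j} - {l}))" for g :: "'i \<Rightarrow> real"
      using J j l by (simp add: sum.remove[of J j] sum.remove[of "J - {j}" l])
    have zu: "sum z (J - {j} - {l}) = sum u (J - {j} - {l})" by (intro sum.cong) (auto simp: z_def)
    have "sum z J = sum u J" unfolding split zu using l by (simp add: z_def)
    then have zs: "z \<in> std_simplex J" using us j l by (auto simp: z_def std_simplex_def)
    have "(\<Sum>i\<in>J - {j} - {l}. \<bar>u i - z i\<bar>) = (\<Sum>i\<in>J - {j} - {l}. 0)"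
      by (intro sum.cong) (auto simp: z_def)
    then have "l1_dist J u z = 2 * u j" unfolding l1_dist_def split
      using l us by (simp add: z_def std_simplex_def)
    also have "u j \<le> \<bar>u j - v j\<bar>" using j by simp
    also have "\<bar>u j - v j\<bar> \<le> l1_dist J u v" unfolding l1_dist_def using J j by (intro member_le_sum) auto
    finally have uz: "l1_dist J u z \<le> 2 * l1_dist J u v" by simp
    have zv: "l1_dist J z v \<le> 3 * l1_dist J u v"
      using l1_dist_triangle[of J z v u] uz l1_dist_commute[of J u z] by linarith
    have "dist (F u) (F v) \<le> dist (F u) (F z) + dist (F z) (F v)" by (rule dist_triangle)
    also have "\<dots> \<le> M * l1_dist J u z + M * l1_dist J z v"
      using F'[of i u z] F'[of j z v] us vs zs i j l False by (intro add_mono) (auto simp: z_def)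
    also have "\<dots> \<le> M * (2 * l1_dist J u v) + M * (3 * l1_dist J u v)"
      using uz zv M by (intro add_mono mult_left_mono) auto
    finally show ?thesis by simp
  qed
qed

lemma vertex_in_std_simplex: "finite J \<Longrightarrow> i \<in> J \<Longrightarrow> (\<lambda>j. if j = i then 1 else 0) \<in> std_simplex J"
  by (auto simp: std_simplex_def)

lemma std_simplex_singleton: "u \<in> std_simplex {i} \<Longrightarrow> u = (\<lambda>j. if j = i then 1 else 0)"
  by (auto simp: std_simplex_def fun_eq_iff)

text \<open>Induction on the dimension of the skeleton. The bound on each simplex refers only to the
  values at its own vertices, so the complex can be that of all simplices with at most \<open>N + 1\<close> vertices
  in the index type. The new map on a simplex of top
  dimension fills the old map on its boundary, and a point belongs to exactly one open simplex, the
  one spanned by its support; this is how the fillings are glued.\<close>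
lemma skeleton_extension:
  assumes "\<And>m. m < N \<Longrightarrow> Lipschitz_connected m (euclidean_metric :: 'b::metric_space metric)"
  shows "\<exists>C\<ge>0. \<forall>y :: 'i \<Rightarrow> 'b. \<exists>F. (\<forall>i. F (\<lambda>j. if j = i then 1 else 0) = y i) \<and>
    (\<forall>J. finite J \<longrightarrow> card J \<le> Suc N \<longrightarrow>
      (\<forall>u\<in>std_simplex J. \<forall>v\<in>std_simplex J. dist (F u) (F v) \<le> C * diameter (y ` J) * l1_dist J u v))"
  using assms
proof (induction N)
  case 0
  show ?case
  proof (intro exI[of _ 0] conjI allI)
    fix y :: "'i \<Rightarrow> 'b"
    let ?F = "\<lambda>u. y (SOME i. u i \<noteq> (0::real))"
    have F: "?F (\<lambda>j. if j = i then 1 else 0) = y i" for i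
      by simp
    show "\<exists>F. (\<forall>i. F (\<lambda>j. if j = i then 1 else 0) = y i) \<and>
      (\<forall>J. finite J \<longrightarrow> card J \<le> Suc 0 \<longrightarrow>
      (\<forall>u\<in>std_simplex J. \<forall>v\<in>std_simplex J. dist (F u) (F v) \<le> 0 * diameter (y ` J) * l1_dist J u v))"
    proof (intro exI[of _ ?F] conjI allI impI ballI F)
      fix J :: "'i set" and u v
      assume J: "finite J" "card J \<le> Suc 0" and u: "u \<in> std_simplex J" and v: "v \<in> std_simplex J"
      have "J \<noteq> {}" using u by (auto simp: std_simplex_def)
      then have "card J = 1" using J by (metis One_nat_def card_0_eq le_SucE le_zero_eq)
      then obtain i where "J = {i}" by (auto simp: card_1_singleton_iff)
      then have "u = v" using std_simplex_singleton[of u i] std_simplex_singleton[of v i] u v by simp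
      then show "dist (?F u) (?F v) \<le> 0 * diameter (y ` J) * l1_dist J u v" by simp
    qed
  qed simp
next
  case (Suc N)
  obtain C where C: "0 \<le> C" and ext: "\<And>y :: 'i \<Rightarrow> 'b. \<exists>F. (\<forall>i. F (\<lambda>j. if j = i then 1 else 0) = y i) \<and>
    (\<forall>J. finite J \<longrightarrow> card J \<le> Suc N \<longrightarrow>
      (\<forall>u\<in>std_simplex J. \<forall>v\<in>std_simplex J. dist (F u) (F v) \<le> C * diameter (y ` J) * l1_dist J u v))"
    using Suc.IH[OF Suc.prems[OF less_SucI]] by blast
  have conn: "Lipschitz_connected N (euclidean_metric :: 'b metric)" using Suc.prems by simp
  obtain C' where C': "0 \<le> C'"
    and fill: "\<And>(J :: 'i set) (h :: ('i \<Rightarrow> real) \<Rightarrow> 'b) L. finite J \<Longrightarrow> card J = Suc (Suc N) \<Longrightarrow> 0 \<le> L \<Longrightarrow>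
        (\<And>u v. u \<in> simplex_boundary J \<Longrightarrow> v \<in> simplex_boundary J \<Longrightarrow>
           dist (h u) (h v) \<le> L * l1_dist J u v) \<Longrightarrow>
        \<exists>g. (\<forall>u\<in>simplex_boundary J. g u = h u) \<and>
          (\<forall>u\<in>std_simplex J. \<forall>v\<in>std_simplex J.
             dist (g u) (g v) \<le> C' * L * l1_dist J u v)"
    by (rule simplex_filling[OF conn, where 'i = 'i]) blast
  let ?C = "C + C' * (5 * C + 1)"
  show ?case
  proof (intro exI[of _ ?C] conjI allI)
    fix y :: "'i \<Rightarrow> 'b"
    from ext[of y] obtain F where F: "(\<forall>i. F (\<lambda>j. if j = i then 1 else 0) = y i) \<and>
      (\<forall>J. finite J \<longrightarrow> card J \<le> Suc N \<longrightarrow>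
        (\<forall>u\<in>std_simplex J. \<forall>v\<in>std_simplex J. dist (F u) (F v) \<le> C * diameter (y ` J) * l1_dist J u v))"
      by (rule exE)
    then have F1: "\<And>i. F (\<lambda>j. if j = i then 1 else 0) = y i"
      and F2: "\<And>J u v. finite J \<Longrightarrow> card J \<le> Suc N \<Longrightarrow> u\<in>std_simplex J \<Longrightarrow> v\<in>std_simplex J \<Longrightarrow>
        dist (F u) (F v) \<le> C * diameter (y ` J) * l1_dist J u v"
      by simp_all
    have diam0: "0 \<le> diameter (y ` J)" if "finite J" for J
      using that by (intro diameter_ge_0) (simp add: finite_imp_bounded)
    have bdry: "dist (F u) (F v) \<le> ((5 * C + 1) * diameter (y ` J)) * l1_dist J u v"
      if J: "finite J" "card J = Suc (Suc N)" and u: "u \<in> simplex_boundary J" and v: "v \<in> simplex_boundary J"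
      for J u v
    \<comment> \<open>The boundary of an edge is disconnected, so its two points are treated directly.\<close>
    proof (cases "N = 0")
      case True
      then have "card J = 2" using J by simp
      then obtain a b where ab: "J = {a, b}" "a \<noteq> b" unfolding card_2_iff by blast
      have vertex: "\<exists>i\<in>J. w = (\<lambda>j. if j = i then 1 else 0)" if "w \<in> simplex_boundary J" for w
      proof -
        have ws: "w \<in> std_simplex J" using that by (simp add: simplex_boundary_def)
        from that consider "w a = 0" | "w b = 0" by (auto simp: simplex_boundary_def ab)
        then show ?thesis
        proof cases
          case 1 then have "w \<in> std_simplex {b}" by (intro std_simplex_face[OF J(1) ws]) (use ab in auto)
          then have "w = (\<lambda>j. if j = b then 1 else 0)" by (rule std_simplex_singleton)
          then show ?thesis by (rule bexI) (simp add: ab)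
        next
          case 2 then have "w \<in> std_simplex {a}" by (intro std_simplex_face[OF J(1) ws]) (use ab in auto)
          then have "w = (\<lambda>j. if j = a then 1 else 0)" by (rule std_simplex_singleton)
          then show ?thesis by (rule bexI) (simp add: ab)
        qed
      qed
      from vertex[OF u] obtain i where i: "i \<in> J" "u = (\<lambda>j. if j = i then 1 else 0)" by (rule bexE)
      from vertex[OF v] obtain k where k: "k \<in> J" "v = (\<lambda>j. if j = k then 1 else 0)" by (rule bexE)
      show ?thesis
      proof (cases "i = k")
        case True
        then have "dist (F u) (F v) = 0" using i k by simp
        then show ?thesis using diam0[OF J(1)] C by (simp add: l1_dist_nonneg)
      next
        case False
        have "dist (F u) (F v) \<le> diameter (y ` J)"
          using i k J F1 by (auto intro!: diameter_bounded_bound finite_imp_bounded)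
        also have "\<dots> \<le> (1 * diameter (y ` J)) * 1" by simp
        also have "\<dots> \<le> ((5 * C + 1) * diameter (y ` J)) * l1_dist J u v"
        proof (intro mult_mono)
          have "1 = \<bar>u i - v i\<bar>" using i k False by simp
          also have "\<dots> \<le> l1_dist J u v" unfolding l1_dist_def using J i by (intro member_le_sum) auto
          finally show "1 \<le> l1_dist J u v" .
        qed (use C diam0[OF J(1)] in auto)
        finally show ?thesis .
      qed
    next
      case False
      have "dist (F u) (F v) \<le> 5 * (C * diameter (y ` J)) * l1_dist J u v"
      proof (rule boundary_lipschitz_from_facets[OF J(1) _ _ _ u v])
        fix i u v assume "i \<in> J" "u \<in> std_simplex (J - {i})" "v \<in> std_simplex (J - {i})"
        then have "dist (F u) (F v) \<le> C * diameter (y ` (J - {i})) * l1_dist (J - {i}) u v"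
          using J by (intro F2) auto
        also have "\<dots> \<le> C * diameter (y ` J) * l1_dist (J - {i}) u v"
          using J C by (intro mult_right_mono mult_left_mono diameter_subset l1_dist_nonneg finite_imp_bounded) auto
        finally show "dist (F u) (F v) \<le> C * diameter (y ` J) * l1_dist (J - {i}) u v" .
      qed (use False J C diam0[OF J(1)] in auto)
      also have "\<dots> = (5 * C * diameter (y ` J)) * l1_dist J u v" by simp
      also have "\<dots> \<le> ((5 * C + 1) * diameter (y ` J)) * l1_dist J u v"
        using diam0[OF J(1)] by (intro mult_right_mono l1_dist_nonneg) auto
      finally show ?thesis .
    qed
    have "\<exists>g. finite J \<longrightarrow> card J = Suc (Suc N) \<longrightarrow> (\<forall>u\<in>simplex_boundary J. g u = F u) \<and>
          (\<forall>u\<in>std_simplex J. \<forall>v\<in>std_simplex J.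
             dist (g u) (g v) \<le> C' * ((5 * C + 1) * diameter (y ` J)) * l1_dist J u v)"
      for J
    proof (cases "finite J \<and> card J = Suc (Suc N)")
      case True
      then have "0 \<le> (5 * C + 1) * diameter (y ` J)" using C diam0[of J] by (simp add: mult_nonneg_nonneg)
      from fill[OF _ _ this bdry] True show ?thesis by blast
    qed auto
    then have "\<forall>J. \<exists>g. finite J \<longrightarrow> card J = Suc (Suc N) \<longrightarrow> (\<forall>u\<in>simplex_boundary J. g u = F u) \<and>
          (\<forall>u\<in>std_simplex J. \<forall>v\<in>std_simplex J.
             dist (g u) (g v) \<le> C' * ((5 * C + 1) * diameter (y ` J)) * l1_dist J u v)" ..
    from choice[OF this] obtain G where
      G: "\<forall>J. finite J \<longrightarrow> card J = Suc (Suc N) \<longrightarrow> (\<forall>u\<in>simplex_boundary J. G J u = F u) \<and>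
          (\<forall>u\<in>std_simplex J. \<forall>v\<in>std_simplex J.
             dist (G J u) (G J v) \<le> C' * ((5 * C + 1) * diameter (y ` J)) * l1_dist J u v)"
      by (rule exE)
    then have G1: "\<And>J u. finite J \<Longrightarrow> card J = Suc (Suc N) \<Longrightarrow> u\<in>simplex_boundary J \<Longrightarrow> G J u = F u"
      and G2: "\<And>J u v. finite J \<Longrightarrow> card J = Suc (Suc N) \<Longrightarrow> u\<in>std_simplex J \<Longrightarrow> v\<in>std_simplex J \<Longrightarrow>
             dist (G J u) (G J v) \<le> C' * ((5 * C + 1) * diameter (y ` J)) * l1_dist J u v"
      by simp_all
    define H where "H u = (if card {i. u i \<noteq> 0} = Suc (Suc N) then G {i. u i \<noteq> 0} u else F u)" for u :: "'i \<Rightarrow> real"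
    have supp: "{i. u i \<noteq> 0} \<subseteq> J" if "u \<in> std_simplex J" for u :: "'i \<Rightarrow> real" and J
      using that by (auto simp: std_simplex_def)
    have low: "H u = F u" if "finite J" "card J \<le> Suc N" "u \<in> std_simplex J" for u J
    proof -
      have "card {i. u i \<noteq> 0} \<le> card J" using that supp by (intro card_mono) auto
      then show ?thesis using that by (simp add: H_def)
    qed
    have high: "H u = G J u" if J: "finite J" "card J = Suc (Suc N)" and u: "u \<in> std_simplex J" for u J
    proof (cases "{i. u i \<noteq> 0} = J")
      case True
      then show ?thesis using J by (simp add: H_def)
    next
      case False
      then have "{i. u i \<noteq> 0} \<subset> J" using supp[OF u] by blast
      then have "card {i. u i \<noteq> 0} < card J" using J by (intro psubset_card_mono)
      moreover have "u \<in> simplex_boundary J" using False supp[OF u] u by (auto simp: simplex_boundary_def)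
      ultimately show ?thesis using J G1 by (simp add: H_def)
    qed
    show "\<exists>F. (\<forall>i. F (\<lambda>j. if j = i then 1 else 0) = y i) \<and>
      (\<forall>J. finite J \<longrightarrow> card J \<le> Suc (Suc N) \<longrightarrow>
      (\<forall>u\<in>std_simplex J. \<forall>v\<in>std_simplex J. dist (F u) (F v) \<le> ?C * diameter (y ` J) * l1_dist J u v))"
    proof (intro exI[of _ H] conjI allI impI ballI)
      fix i
      show "H (\<lambda>j. if j = i then 1 else 0) = y i"
        using low[of "{i}"] vertex_in_std_simplex[of "{i}" i] F1 by simp
    next
      fix J :: "'i set" and u v
      assume J: "finite J" "card J \<le> Suc (Suc N)" and u: "u \<in> std_simplex J" and v: "v \<in> std_simplex J"
      have mono: "c * diameter (y ` J) * l1_dist J u v \<le> ?C * diameter (y ` J) * l1_dist J u v"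
        if "c \<le> ?C" for c
        using that diam0[OF J(1)] by (intro mult_right_mono l1_dist_nonneg)
      consider "card J \<le> Suc N" | "card J = Suc (Suc N)" using J by linarith
      then show "dist (H u) (H v) \<le> ?C * diameter (y ` J) * l1_dist J u v"
      proof cases
        case 1
        have "dist (H u) (H v) \<le> C * diameter (y ` J) * l1_dist J u v"
          unfolding low[OF J(1) 1 u] low[OF J(1) 1 v] by (rule F2[OF J(1) 1 u v])
        also have "\<dots> \<le> ?C * diameter (y ` J) * l1_dist J u v" by (rule mono) (use C C' in simp)
        finally show ?thesis .
      next
        case 2
        have "dist (H u) (H v) \<le> C' * ((5 * C + 1) * diameter (y ` J)) * l1_dist J u v"
          unfolding high[OF J(1) 2 u] high[OF J(1) 2 v] by (rule G2[OF J(1) 2 u v])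
        also have "\<dots> = C' * (5 * C + 1) * diameter (y ` J) * l1_dist J u v" by (simp only: mult.assoc)
        also have "\<dots> \<le> ?C * diameter (y ` J) * l1_dist J u v" by (rule mono) (use C in simp)
        finally show ?thesis .
      qed
    qed
  qed (use C C' in auto)
qed

section \<open>Coverings and Whitney weights\<close>

lemma infdist_lessE:
  fixes x :: "'a::metric_space"
  assumes "A \<noteq> {}" "infdist x A < d"
  obtains a where "a \<in> A" "dist x a < d"
proof -
  have "(INF a\<in>A. dist x a) < d" using assms by (simp add: infdist_notempty)
  then show ?thesis using that assms by (auto simp: cINF_less_iff)
qed

text \<open>An admissible integer below \<open>n + 1\<close> is at most \<open>n\<close>, and an infimum of extended naturals is attained.
  Empty members can be discarded, as they are counted by no test set.\<close>
lemma nagata_dim_coveringE: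
  fixes Z :: "'a::metric_space set"
  assumes "nagata_dim Z \<le> ereal (of_int n)"
  obtains c where "0 < c"
    and "\<And>s. 0 < s \<Longrightarrow> \<exists>(I :: 'a set set) B. (\<Union>i\<in>I. B i) = Z \<and>
          (\<forall>i\<in>I. B i \<noteq> {} \<and> (\<forall>x\<in>B i. \<forall>y\<in>B i. dist x y \<le> c * s)) \<and>
          (\<forall>A\<subseteq>Z. diam_at_most A s \<longrightarrow>
             finite {i\<in>I. B i \<inter> A \<noteq> {}} \<and> card {i\<in>I. B i \<inter> A \<noteq> {}} \<le> nat (n + 1))"
proof -
  have "nagata_dim Z < ereal (of_int (n + 1))"
    using assms by (rule le_less_trans) simp
  then obtain n' c where n': "ereal (of_int n') < ereal (of_int (n + 1))" and c: "0 < c"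
    and cov: "\<forall>s>0. \<exists>(I :: 'a set set) (B :: 'a set \<Rightarrow> 'a set).
            covering_of Z I B \<and> bounded_family (c * s) I B \<and>
            ereal_of_enat (s_multiplicity s Z I B) \<le> ereal (of_int (n' + 1))"
    unfolding nagata_dim_def Inf_less_iff by blast
  show ?thesis
  proof (rule that[OF c])
    fix s :: real assume s: "0 < s"
    then obtain I and B :: "'a set \<Rightarrow> 'a set" where cover: "covering_of Z I B" and bd: "bounded_family (c * s) I B"
      and mult: "ereal_of_enat (s_multiplicity s Z I B) \<le> ereal (of_int (n' + 1))"
      using cov by blast
    let ?good = "\<lambda>m. \<forall>A\<subseteq>Z. diam_at_most A s \<longrightarrow>
            finite {i\<in>I. B i \<inter> A \<noteq> {}} \<and> card {i\<in>I. B i \<inter> A \<noteq> {}} \<le> m"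
    obtain m where m: "s_multiplicity s Z I B = enat m"
      using mult by (cases "s_multiplicity s Z I B") auto
    have "{enat m | m. ?good m} \<noteq> {}"
    proof
      assume "{enat m | m. ?good m} = {}"
      then have "s_multiplicity s Z I B = Inf {}" unfolding s_multiplicity_def by (rule arg_cong)
      then show False using m by (simp add: top_enat_def)
    qed
    then obtain e where "e \<in> {enat m | m. ?good m}" by (meson all_not_in_conv)
    then have "s_multiplicity s Z I B \<in> {enat m | m. ?good m}"
      unfolding s_multiplicity_def by (rule wellorder_InfI)
    then have good: "?good m" unfolding m by (elim CollectE exE conjE) simp
    have "real m \<le> of_int (n' + 1)" using mult m by simp
    then have "m \<le> nat (n + 1)" using n' by simp
    then have good': "?good (nat (n + 1))" using good order.trans by blast
    define I' where "I' = {i\<in>I. B i \<noteq> {}}"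
    have same: "{i\<in>I'. B i \<inter> A \<noteq> {}} = {i\<in>I. B i \<inter> A \<noteq> {}}" for A by (auto simp: I'_def)
    have "dist x y \<le> c * s" if "i \<in> I'" "x \<in> B i" "y \<in> B i" for i x y
    proof -
      have "bounded (B i)" "diameter (B i) \<le> c * s"
        using bd that by (auto simp: bounded_family_def diam_at_most_def I'_def)
      then show ?thesis using diameter_bounded_bound[of "B i" x y] that by linarith
    qed
    moreover have "(\<Union>i\<in>I'. B i) = Z" using cover by (auto simp: covering_of_def I'_def)
    moreover have "\<forall>i\<in>I'. B i \<noteq> {}" by (simp add: I'_def)
    ultimately show "\<exists>(I :: 'a set set) B. (\<Union>i\<in>I. B i) = Z \<and>
          (\<forall>i\<in>I. B i \<noteq> {} \<and> (\<forall>x\<in>B i. \<forall>y\<in>B i. dist x y \<le> c * s)) \<and>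
          (\<forall>A\<subseteq>Z. diam_at_most A s \<longrightarrow>
             finite {i\<in>I. B i \<inter> A \<noteq> {}} \<and> card {i\<in>I. B i \<inter> A \<noteq> {}} \<le> nat (n + 1))"
      using good' by (intro exI[of _ I'] exI[of _ B]) (simp add: same)
  qed
qed

text \<open>A sum over a possibly infinite family with finitely many nonzero entries, where the plain sum over
  \<open>P\<close> would be 0 by convention.\<close>
definition sparse_sum :: "'i set \<Rightarrow> ('i \<Rightarrow> real) \<Rightarrow> real" where
  "sparse_sum P u = sum u {j \<in> P. u j \<noteq> 0}"

lemma sparse_sum_eq:
  assumes "finite T" "{j \<in> P. u j \<noteq> 0} \<subseteq> T" "T \<subseteq> P"
  shows "sparse_sum P u = sum u T"
  unfolding sparse_sum_def using assms by (intro sum.mono_neutral_left) auto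

text \<open>Only the indices in one of the two supports contribute, which makes the constant depend on the
  size of the supports and not on the size of the family.\<close>
lemma sparse_sum_lipschitz:
  assumes "finite {j \<in> P. u j \<noteq> 0}" "card {j \<in> P. u j \<noteq> 0} \<le> N"
    and "finite {j \<in> P. v j \<noteq> 0}" "card {j \<in> P. v j \<noteq> 0} \<le> N"
    and d: "\<And>j. j \<in> P \<Longrightarrow> \<bar>u j - v j\<bar> \<le> d" and "0 \<le> d"
  shows "\<bar>sparse_sum P u - sparse_sum P v\<bar> \<le> 2 * real N * d"
proof -
  let ?T = "{j \<in> P. u j \<noteq> 0} \<union> {j \<in> P. v j \<noteq> 0}"
  have "sparse_sum P u = sum u ?T" "sparse_sum P v = sum v ?T"
    using assms by (intro sparse_sum_eq; auto)+
  then have "\<bar>sparse_sum P u - sparse_sum P v\<bar> = \<bar>\<Sum>j\<in>?T. u j - v j\<bar>" by (simp add: sum_subtractf)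
  also have "\<dots> \<le> (\<Sum>j\<in>?T. \<bar>u j - v j\<bar>)" by (rule sum_abs)
  also have "\<dots> \<le> real (card ?T) * d" using d by (intro sum_bounded_above) auto
  also have "card ?T \<le> 2 * N" using card_Un_le[of "{j \<in> P. u j \<noteq> 0}" "{j \<in> P. v j \<noteq> 0}"] assms by linarith
  then have "real (card ?T) * d \<le> 2 * real N * d" using assms by (intro mult_right_mono) linarith+
  finally show ?thesis .
qed

lemma sparse_sum_bounds:
  assumes "card {j \<in> P. u j \<noteq> 0} \<le> N" "\<And>j. j \<in> P \<Longrightarrow> 0 \<le> u j" "\<And>j. j \<in> P \<Longrightarrow> u j \<le> 1"
  shows "0 \<le> sparse_sum P u" "sparse_sum P u \<le> real N"
proof -
  show "0 \<le> sparse_sum P u" unfolding sparse_sum_def using assms by (intro sum_nonneg) auto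
  have "sparse_sum P u \<le> real (card {j \<in> P. u j \<noteq> 0}) * 1"
    unfolding sparse_sum_def using assms by (intro sum_bounded_above) auto
  then show "sparse_sum P u \<le> real N" using assms(1) by simp
qed

lemma abs_min_diff_le:
  fixes a :: real
  assumes "\<bar>a - a'\<bar> \<le> d" "\<bar>b - b'\<bar> \<le> d"
  shows "\<bar>min a b - min a' b'\<bar> \<le> d"
  using assms by linarith

lemma abs_mult_diff_le:
  fixes a :: real
  assumes "\<bar>a - a'\<bar> \<le> d" "\<bar>b - b'\<bar> \<le> e" "\<bar>b\<bar> \<le> B" "\<bar>a'\<bar> \<le> A"
  shows "\<bar>a * b - a' * b'\<bar> \<le> d * B + A * e"
proof -
  have "a * b - a' * b' = (a - a') * b + a' * (b - b')" by (simp add: algebra_simps)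
  also have "\<bar>\<dots>\<bar> \<le> \<bar>a - a'\<bar> * \<bar>b\<bar> + \<bar>a'\<bar> * \<bar>b - b'\<bar>"
    by (intro order.trans[OF abs_triangle_ineq]) (simp add: abs_mult)
  also have "\<dots> \<le> d * B + A * e" using assms by (intro add_mono mult_mono) linarith+
  finally show ?thesis .
qed

text \<open>Coverings of \<open>Z\<close> at the scales \<open>s = 8 r\<^sup>k\<^sup>+\<^sup>1\<close>, for all integers \<open>k\<close>. The points of \<open>Z\<close> closer than \<open>s / 2\<close> to a given
  point form a set of diameter at most \<open>s\<close>, so they meet at most \<open>N\<close> members; this is the form in which the
  multiplicity enters. The ratio \<open>r\<close> is so large that a point near a member at scale \<open>k\<close>
  is near every member at scale \<open>k + 1\<close> that contains its base point (\<open>bump_parent\<close>), and that the three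
  thresholds \<open>r\<^sup>k\<close>, \<open>2 r\<^sup>k\<close>, \<open>3 r\<^sup>k\<close> at which weights change lie below \<open>r\<^sup>k\<^sup>+\<^sup>1\<close>. The strict linear
  order \<open>R\<close> orders the vertices of the prisms.\<close>
locale scaled_covers =
  fixes Z :: "'a::metric_space set" and N :: nat and c r :: real
    and I :: "int \<Rightarrow> 'i set" and B :: "int \<Rightarrow> 'i \<Rightarrow> 'a set" and p :: "int \<Rightarrow> 'i \<Rightarrow> 'a"
    and R :: "('i \<times> 'i) set"
  assumes c_pos: "0 < c" and r_def: "r = 4 + 2 * c" and Z_nonempty: "Z \<noteq> {}"
    and covers: "(\<Union>i\<in>I k. B k i) = Z"
    and base_point: "i \<in> I k \<Longrightarrow> p k i \<in> B k i"
    and small: "i \<in> I k \<Longrightarrow> x \<in> B k i \<Longrightarrow> y \<in> B k i \<Longrightarrow> dist x y \<le> 8 * c * r powi (k + 1)"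
    and finite_near: "finite {i \<in> I k. infdist x (B k i) < 4 * r powi (k + 1)}"
    and card_near: "card {i \<in> I k. infdist x (B k i) < 4 * r powi (k + 1)} \<le> N"
    and R_trans: "trans R" and R_irrefl: "irrefl R" and R_total: "total R"
begin

abbreviation unit :: "int \<Rightarrow> real" where "unit k \<equiv> r powi k"
abbreviation \<delta> :: "'a \<Rightarrow> real" where "\<delta> x \<equiv> infdist x Z"

text \<open>The unnormalized barycentric coordinates of \<open>x\<close> in the nerve of the covering at scale \<open>k\<close>.\<close>
definition bump :: "int \<Rightarrow> 'i \<Rightarrow> 'a \<Rightarrow> real" where
  "bump k i x = (if i \<in> I k then max 0 (1 - infdist x (B k i) / (4 * unit (k + 1))) else 0)"

definition prefix :: "int \<Rightarrow> 'i \<Rightarrow> 'a \<Rightarrow> real" where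
  "prefix k i x = sparse_sum {j. (j, i) \<in> R} (\<lambda>j. bump k j x)"

text \<open>The level at which the total mass of the coordinates is cut: it is at least \<open>N\<close>, a bound for the total
  mass, as long as \<open>\<delta> x \<le> r\<^sup>k\<close>, and is nonpositive from \<open>\<delta> x = 2 r\<^sup>k\<close> on.\<close>
definition height :: "int \<Rightarrow> 'a \<Rightarrow> real" where
  "height k x = real N * (2 - \<delta> x / unit k)"

text \<open>Stacking the bumps in the order \<open>R\<close> assigns to each index \<open>i\<close> an interval of length \<open>bump k i x\<close>. The
  part below the cut is the weight of the bottom vertex of the prism, the part above the cut is
  that of the top vertex. These are the coordinates of the standard triangulation of the prism.\<close>
definition lower :: "int \<Rightarrow> 'i \<Rightarrow> 'a \<Rightarrow> real" where
  "lower k i x = min (prefix k i x + bump k i x) (height k x) - min (prefix k i x) (height k x)"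

definition upper :: "int \<Rightarrow> 'i \<Rightarrow> 'a \<Rightarrow> real" where
  "upper k i x = bump k i x - lower k i x"

text \<open>The parameter of the second phase, the linear motion from the image of the old simplex
  to the coordinates at scale \<open>k + 1\<close>; it runs from 0 at \<open>2 r\<^sup>k\<close> to 1 at \<open>3 r\<^sup>k\<close>.\<close>
definition blend :: "int \<Rightarrow> 'a \<Rightarrow> real" where
  "blend k x = max 0 (min 1 (\<delta> x / unit k - 2))"

definition parent :: "int \<Rightarrow> 'i \<Rightarrow> 'i" where
  "parent k i = (SOME j. j \<in> I (k + 1) \<and> p k i \<in> B (k + 1) j)"

definition inherited :: "int \<Rightarrow> 'i \<Rightarrow> 'a \<Rightarrow> real" where
  "inherited k i x = sparse_sum {j \<in> I k. parent k j = i} (\<lambda>j. upper k j x)"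

text \<open>One formula covers all phases: for each \<open>x\<close> most factors are 0 or 1. With \<open>m\<close> the scale of \<open>x\<close>, a vertex
  \<open>(k, i)\<close> receives mass from scale \<open>k - 1\<close> when \<open>k = m + 1\<close>, and loses it to scale \<open>k + 1\<close> when
  \<open>k = m\<close>. A formula valid on the whole space avoids any case distinction on the scales of two points when
  Lipschitz bounds are proved.\<close>
definition weight :: "'a \<Rightarrow> int \<times> 'i \<Rightarrow> real" where
  "weight x = (\<lambda>(k, i). blend (k - 1) x * lower k i x + (1 - blend (k - 1) x) * inherited (k - 1) i x)"

lemma r_ge: "4 \<le> r" using c_pos r_def by simp

lemma unit_pos [simp]: "0 < unit k" using r_ge by (intro zero_less_power_int) simp

lemma unit_nonneg [simp]: "0 \<le> unit k" by (rule less_imp_le[OF unit_pos])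

lemma unit_Suc: "unit (k + 1) = r * unit k"
  using r_ge by (simp add: power_int_add mult.commute)

lemma unit_pred: "unit k = r * unit (k - 1)"
  using unit_Suc[of "k - 1"] by simp

lemma unit_mono: "k \<le> m \<Longrightarrow> unit k \<le> unit m"
  using r_ge by (intro power_int_increasing) auto

lemma \<delta>_lipschitz: "\<bar>\<delta> x - \<delta> y\<bar> \<le> dist x y"
  by (rule infdist_triangle_abs)

lemma bump_bounds: "0 \<le> bump k i x" "bump k i x \<le> 1"
  using r_ge by (auto simp: bump_def infdist_nonneg)

lemma bump_support: "{i. bump k i x \<noteq> 0} = {i \<in> I k. infdist x (B k i) < 4 * unit (k + 1)}"
proof -
  have "(0 < 1 - infdist x (B k i) / (4 * unit (k + 1))) \<longleftrightarrow> infdist x (B k i) < 4 * unit (k + 1)" for i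
    using unit_pos[of "k + 1"] by (simp add: field_simps)
  moreover have "(max 0 a \<noteq> 0) \<longleftrightarrow> 0 < a" for a :: real by auto
  ultimately show ?thesis by (auto simp: bump_def simp del: unit_pos)
qed

lemma bump_near: "bump k i x \<noteq> 0 \<longleftrightarrow> i \<in> I k \<and> infdist x (B k i) < 4 * unit (k + 1)"
  using bump_support[of k x] by blast

lemma finite_bump_support: "finite {i. bump k i x \<noteq> 0}"
  and card_bump_support: "card {i. bump k i x \<noteq> 0} \<le> N"
  unfolding bump_support using finite_near card_near by blast+

lemma finite_card_subset: "A \<subseteq> S \<Longrightarrow> finite S \<Longrightarrow> card S \<le> n \<Longrightarrow> finite A \<and> card A \<le> n"
  by (meson card_mono finite_subset order.trans)

lemma sub_bump_support:
  assumes "\<And>i. i \<in> P \<Longrightarrow> u i \<noteq> 0 \<Longrightarrow> bump k i x \<noteq> 0"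
  shows "finite {i \<in> P. u i \<noteq> 0}" "card {i \<in> P. u i \<noteq> 0} \<le> N"
proof -
  have "{i \<in> P. u i \<noteq> 0} \<subseteq> {i. bump k i x \<noteq> 0}" using assms by auto
  from finite_card_subset[OF this finite_bump_support card_bump_support]
  show "finite {i \<in> P. u i \<noteq> 0}" "card {i \<in> P. u i \<noteq> 0} \<le> N" by simp_all
qed

lemma bump_lipschitz: "\<bar>bump k i x - bump k i y\<bar> \<le> dist x y / unit k"
proof (cases "i \<in> I k")
  case True
  let ?w = "4 * unit (k + 1)"
  have "unit k \<le> ?w" using unit_mono[of k "k + 1"] unit_pos[of "k+1"] by linarith
  have "\<bar>bump k i x - bump k i y\<bar> \<le> \<bar>infdist x (B k i) / ?w - infdist y (B k i) / ?w\<bar>"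
    using True by (simp add: bump_def)
  also have "\<dots> = \<bar>infdist x (B k i) - infdist y (B k i)\<bar> / ?w"
    using unit_pos[of "k + 1"] by (simp only: diff_divide_distrib[symmetric] abs_divide)
  also have "\<dots> \<le> dist x y / ?w"
    using unit_pos[of "k+1"] by (intro divide_right_mono infdist_triangle_abs) simp
  also have "\<dots> \<le> dist x y / unit k" using \<open>unit k \<le> ?w\<close> by (intro divide_left_mono) auto
  finally show ?thesis .
qed (simp add: bump_def less_imp_le)

lemma bump_large:
  assumes "\<delta> x < 2 * unit (k + 1)"
  obtains i where "i \<in> I k" "1 / 2 \<le> bump k i x"
proof -
  obtain b where b: "b \<in> Z" "dist x b < 2 * unit (k + 1)"
    using infdist_lessE[OF Z_nonempty assms] by blast
  then obtain i where i: "i \<in> I k" "b \<in> B k i" using covers[of k] by auto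
  then have "infdist x (B k i) \<le> 2 * unit (k + 1)" using b infdist_le[of b "B k i" x] by linarith
  then have "infdist x (B k i) / (4 * unit (k + 1)) \<le> 1 / 2"
    using unit_pos[of "k + 1"] by (simp add: field_simps)
  then have "1 / 2 \<le> 1 - infdist x (B k i) / (4 * unit (k + 1))" by linarith
  also have "\<dots> \<le> bump k i x" using i by (simp add: bump_def)
  finally show ?thesis using i that by blast
qed

lemma bump_dist:
  assumes "bump k i x \<noteq> 0" shows "dist x (p k i) < 4 * r * unit (k + 1)"
proof -
  have i: "i \<in> I k" "infdist x (B k i) < 4 * unit (k + 1)" using assms by (auto simp: bump_near)
  have "B k i \<noteq> {}" using base_point[OF i(1)] by auto
  then obtain b where b: "b \<in> B k i" "dist x b < 4 * unit (k + 1)"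
    using infdist_lessE i by blast
  have "dist x (p k i) \<le> dist x b + dist b (p k i)" by (rule dist_triangle)
  also have "\<dots> < 4 * unit (k + 1) + 8 * c * unit (k + 1)"
    using b small[OF i(1) b(1) base_point[OF i(1)]] by linarith
  also have "\<dots> \<le> 4 * r * unit (k + 1)" using unit_pos[of "k+1"] by (simp add: r_def algebra_simps)
  finally show ?thesis .
qed

lemma parent: assumes "i \<in> I k" shows "parent k i \<in> I (k + 1)" "p k i \<in> B (k + 1) (parent k i)"
proof -
  have "p k i \<in> Z" using base_point[OF assms] covers[of k] assms by blast
  then have "\<exists>j. j \<in> I (k + 1) \<and> p k i \<in> B (k + 1) j" using covers[of "k + 1"] by blast
  from someI_ex[OF this] show "parent k i \<in> I (k + 1)" "p k i \<in> B (k + 1) (parent k i)"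
    unfolding parent_def by blast+
qed

text \<open>The map \<open>parent\<close> is simplicial, even in a strong sense: all parents of members near \<open>x\<close> are among
  the members near \<open>x\<close> at the next scale. Hence the second phase stays inside one simplex.\<close>
lemma bump_parent:
  assumes "bump k i x \<noteq> 0" shows "bump (k + 1) (parent k i) x \<noteq> 0"
proof -
  have i: "i \<in> I k" using assms by (simp add: bump_near)
  have "infdist x (B (k + 1) (parent k i)) \<le> dist x (p k i)" by (intro infdist_le parent i)
  also have "\<dots> < 4 * r * unit (k + 1)" by (rule bump_dist[OF assms])
  also have "\<dots> \<le> 4 * unit (k + 1 + 1)" using unit_Suc[of "k + 1"] unit_pos[of "k+1+1"] by linarith
  finally show ?thesis using parent[OF i] by (simp add: bump_near)
qed

lemma prefix_nonneg: "0 \<le> prefix k i x"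
  unfolding prefix_def sparse_sum_def by (intro sum_nonneg bump_bounds)

lemma prefix_step:
  assumes "(i, i') \<in> R" shows "prefix k i x + bump k i x \<le> prefix k i' x"
proof -
  let ?T = "\<lambda>i. {j \<in> {j. (j, i) \<in> R}. bump k j x \<noteq> 0}"
  have fin: "finite (?T i)" for i by (rule sub_bump_support(1)[of _ _ k x]) simp
  show ?thesis
  proof (cases "bump k i x = 0")
    case True
    have "prefix k i x \<le> prefix k i' x" unfolding prefix_def sparse_sum_def
      using assms R_trans fin bump_bounds by (intro sum_mono2) (auto dest: transD)
    with True show ?thesis by simp
  next
    case False
    have "i \<notin> ?T i" using R_irrefl by (auto simp: irrefl_def)
    then have "prefix k i x + bump k i x = (\<Sum>j\<in>insert i (?T i). bump k j x)"
      unfolding prefix_def sparse_sum_def using fin by simp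
    also have "\<dots> \<le> prefix k i' x" unfolding prefix_def sparse_sum_def
      using assms R_trans fin bump_bounds False by (intro sum_mono2) (auto dest: transD)
    finally show ?thesis .
  qed
qed

lemma prefix_bump_le:
  assumes "bump k i x \<noteq> 0" shows "prefix k i x + bump k i x \<le> real N"
proof -
  let ?T = "{j \<in> {j. (j, i) \<in> R}. bump k j x \<noteq> 0}"
  have fin: "finite ?T" by (rule sub_bump_support(1)[of _ _ k x]) simp
  have "i \<notin> ?T" using R_irrefl by (auto simp: irrefl_def)
  then have "prefix k i x + bump k i x = (\<Sum>j\<in>insert i ?T. bump k j x)"
    unfolding prefix_def sparse_sum_def using fin by simp
  also have "\<dots> \<le> (\<Sum>j\<in>{j. bump k j x \<noteq> 0}. bump k j x)"
    using assms bump_bounds finite_bump_support[of k x] by (intro sum_mono2) auto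
  also have "\<dots> \<le> real (card {j. bump k j x \<noteq> 0}) * 1"
    by (intro sum_bounded_above bump_bounds)
  also have "\<dots> \<le> real N" using card_bump_support[of k x] by simp
  finally show ?thesis .
qed

lemma lower_bounds: "0 \<le> lower k i x" "lower k i x \<le> bump k i x"
  using bump_bounds[of k i x] by (auto simp: lower_def min_def)

lemma upper_bounds: "0 \<le> upper k i x" "upper k i x \<le> bump k i x"
  using lower_bounds[of k i x] by (auto simp: upper_def)

lemma lower_support: "lower k i x \<noteq> 0 \<Longrightarrow> bump k i x \<noteq> 0"
  using lower_bounds[of k i x] by auto

lemma upper_support: "upper k i x \<noteq> 0 \<Longrightarrow> bump k i x \<noteq> 0"
  using upper_bounds[of k i x] by auto

text \<open>The intervals of distinct indices do not overlap, so only one of them contains the cut in its interior.\<close>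
lemma at_most_one_split:
  assumes "lower k i x \<noteq> 0" "upper k i x \<noteq> 0" "lower k i' x \<noteq> 0" "upper k i' x \<noteq> 0"
  shows "i = i'"
proof (rule ccontr)
  have *: "prefix k j x < height k x \<and> height k x < prefix k j x + bump k j x"
    if "lower k j x \<noteq> 0" "upper k j x \<noteq> 0" for j
    using that bump_bounds[of k j x] by (auto simp: lower_def upper_def min_def split: if_splits)
  assume "i \<noteq> i'"
  then have "(i, i') \<in> R \<or> (i', i) \<in> R" using R_total by (auto simp: total_on_def)
  then show False using *[of i] *[of i'] assms prefix_step[of i i' k x] prefix_step[of i' i k x] by linarith
qed

lemma lower_eq_bump:
  assumes "\<delta> x \<le> unit k" shows "lower k i x = bump k i x"
proof (cases "bump k i x = 0")
  case False
  have "\<delta> x / unit k \<le> 1" using assms by simp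
  then have "real N * 1 \<le> height k x" unfolding height_def by (intro mult_left_mono) auto
  then show ?thesis using prefix_bump_le[OF False] bump_bounds[of k i x] by (simp add: lower_def)
qed (simp add: lower_def)

lemma lower_eq_0:
  assumes "2 * unit k \<le> \<delta> x" shows "lower k i x = 0"
proof -
  have "2 \<le> \<delta> x / unit k" using assms by (simp add: field_simps)
  then have "height k x \<le> 0" unfolding height_def by (intro mult_nonneg_nonpos) auto
  then show ?thesis using prefix_nonneg[of k i x] bump_bounds[of k i x] by (simp add: lower_def)
qed

lemma blend_bounds: "0 \<le> blend k x" "blend k x \<le> 1" by (auto simp: blend_def)

lemma blend_eq_0: "\<delta> x \<le> 2 * unit k \<Longrightarrow> blend k x = 0"
  using pos_divide_le_eq[OF unit_pos[of k], of "\<delta> x" 2] by (simp add: blend_def)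

lemma blend_eq_1: "3 * unit k \<le> \<delta> x \<Longrightarrow> blend k x = 1"
  using pos_le_divide_eq[OF unit_pos[of k], of 3 "\<delta> x"] by (simp add: blend_def)

lemma prefix_lipschitz: "\<bar>prefix k i x - prefix k i y\<bar> \<le> 2 * real N * (dist x y / unit k)"
  unfolding prefix_def
  by (intro sparse_sum_lipschitz bump_lipschitz sub_bump_support[of _ _ k x] sub_bump_support[of _ _ k y])
     (auto simp: less_imp_le)

lemma \<delta>_unit_lipschitz: "\<bar>\<delta> x / unit k - \<delta> y / unit k\<bar> \<le> dist x y / unit k"
proof -
  have "\<bar>\<delta> x / unit k - \<delta> y / unit k\<bar> = \<bar>\<delta> x - \<delta> y\<bar> / unit k"
    using unit_pos[of k] by (simp only: diff_divide_distrib[symmetric] abs_divide)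
  then show ?thesis using \<delta>_lipschitz[of x y] by (simp add: divide_right_mono less_imp_le)
qed

lemma height_lipschitz: "\<bar>height k x - height k y\<bar> \<le> real N * (dist x y / unit k)"
proof -
  have "height k x - height k y = real N * (\<delta> y / unit k - \<delta> x / unit k)"
    by (simp add: height_def algebra_simps)
  then have "\<bar>height k x - height k y\<bar> = real N * \<bar>\<delta> y / unit k - \<delta> x / unit k\<bar>" by (simp add: abs_mult)
  also have "\<dots> \<le> real N * (dist x y / unit k)"
    using \<delta>_unit_lipschitz[of x k y] by (intro mult_left_mono) (auto simp: abs_minus_commute)
  finally show ?thesis .
qed

lemma lower_lipschitz: "\<bar>lower k i x - lower k i y\<bar> \<le> (4 * real N + 1) * (dist x y / unit k)"
proof -
  define e where "e = dist x y / unit k"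
  have e: "0 \<le> e" "0 \<le> real N * e" using unit_pos[of k] by (auto simp: e_def less_imp_le)
  note lip = prefix_lipschitz[of k i x y, folded e_def, unfolded mult.assoc]
    bump_lipschitz[of k i x y, folded e_def] height_lipschitz[of k x y, folded e_def]
  have "\<bar>min (prefix k i x + bump k i x) (height k x) - min (prefix k i y + bump k i y) (height k y)\<bar>
        \<le> 2 * (real N * e) + e"
    using lip e
    by (intro abs_min_diff_le) linarith+
  moreover have "\<bar>min (prefix k i x) (height k x) - min (prefix k i y) (height k y)\<bar> \<le> 2 * (real N * e)"
    using lip e by (intro abs_min_diff_le) linarith+
  moreover have "\<bar>(a - b) - (a' - b')\<bar> \<le> s + t" if "\<bar>a - a'\<bar> \<le> s" "\<bar>b - b'\<bar> \<le> t" for a a' b b' s t :: real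
    using that by linarith
  ultimately have "\<bar>lower k i x - lower k i y\<bar> \<le> 2 * (real N * e) + e + 2 * (real N * e)"
    unfolding lower_def by blast
  then show ?thesis unfolding e_def[symmetric] by (simp add: algebra_simps)
qed

lemma upper_lipschitz: "\<bar>upper k i x - upper k i y\<bar> \<le> (4 * real N + 2) * (dist x y / unit k)"
  using lower_lipschitz[of k i x y] bump_lipschitz[of k i x y] unfolding upper_def distrib_right by linarith

lemma inherited_bounds: "0 \<le> inherited k i x" "inherited k i x \<le> real N"
proof -
  have "upper k j x \<le> 1" for j using upper_bounds[of k j x] bump_bounds[of k j x] by linarith
  moreover have "card {j \<in> {j \<in> I k. parent k j = i}. upper k j x \<noteq> 0} \<le> N"
    by (rule sub_bump_support(2)[of _ _ k x]) (rule upper_support)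
  ultimately show "0 \<le> inherited k i x" "inherited k i x \<le> real N"
    unfolding inherited_def using upper_bounds(1) by (simp_all add: sparse_sum_bounds)
qed

lemma inherited_lipschitz:
  "\<bar>inherited k i x - inherited k i y\<bar> \<le> 2 * real N * ((4 * real N + 2) * (dist x y / unit k))"
  unfolding inherited_def
  by (intro sparse_sum_lipschitz upper_lipschitz sub_bump_support[of _ _ k x, OF upper_support]
      sub_bump_support[of _ _ k y, OF upper_support])
     (auto simp: less_imp_le)

lemma inherited_support:
  assumes "inherited k i x \<noteq> 0"
  obtains j where "j \<in> I k" "parent k j = i" "upper k j x \<noteq> 0"
proof -
  have "{j \<in> {j \<in> I k. parent k j = i}. upper k j x \<noteq> 0} \<noteq> {}"
    using assms unfolding inherited_def sparse_sum_def by (metis sum.empty)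
  then show ?thesis using that by blast
qed

lemma inherited_ge:
  assumes "j \<in> I k" shows "upper k j x \<le> inherited k (parent k j) x"
proof (cases "upper k j x = 0")
  case False
  let ?S = "{j' \<in> {j' \<in> I k. parent k j' = parent k j}. upper k j' x \<noteq> 0}"
  have "finite ?S" by (rule sub_bump_support(1)[of _ _ k x, OF upper_support])
  then show ?thesis unfolding inherited_def sparse_sum_def
    using assms False upper_bounds by (intro member_le_sum) auto
qed (use inherited_bounds in simp)

lemma blend_lipschitz: "\<bar>blend k x - blend k y\<bar> \<le> dist x y / unit k"
proof -
  have "\<bar>max 0 (min 1 (a - 2)) - max 0 (min 1 (b - 2))\<bar> \<le> \<bar>a - b\<bar>" for a b :: real by (simp add: max_def min_def)
  then show ?thesis using \<delta>_unit_lipschitz[of x k y] unfolding blend_def by (rule order.trans)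
qed

definition weight_lip :: real where
  "weight_lip = (4 * real N + 1) + r + r * real N + 2 * real N * (4 * real N + 2) * r"

lemma weight_lip_nonneg: "0 \<le> weight_lip" using r_ge by (simp add: weight_lip_def)

text \<open>The bound holds for all pairs of points and is inversely proportional to the scale of the
  vertex, since each ingredient is a bounded Lipschitz function with such a constant.\<close>
lemma weight_lipschitz: "\<bar>weight x (k, i) - weight y (k, i)\<bar> \<le> weight_lip * (dist x y / unit k)"
proof -
  let ?e = "dist x y / unit k"
  have e: "0 \<le> ?e" using unit_pos[of k] by (simp add: less_imp_le)
  have pred: "dist x y / unit (k - 1) = r * ?e"
    using unit_pred[of k] unit_pos[of k] unit_pos[of "k - 1"] r_ge by (simp add: field_simps)
  have b: "\<bar>blend (k - 1) x - blend (k - 1) y\<bar> \<le> r * ?e" using blend_lipschitz[of "k - 1" x y] pred by simp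
  have "\<bar>blend (k - 1) x * lower k i x - blend (k - 1) y * lower k i y\<bar>
        \<le> (r * ?e) * 1 + 1 * ((4 * real N + 1) * ?e)"
    using b lower_lipschitz[of k i x y] lower_bounds[of k i x] bump_bounds[of k i x] blend_bounds[of "k - 1" y]
    by (intro abs_mult_diff_le) auto
  moreover have "\<bar>(1 - blend (k - 1) x) * inherited (k - 1) i x - (1 - blend (k - 1) y) * inherited (k - 1) i y\<bar>
        \<le> (r * ?e) * real N + 1 * (2 * real N * ((4 * real N + 2) * (r * ?e)))"
    using b inherited_lipschitz[of "k - 1" i x y] inherited_bounds[of "k - 1" i x] blend_bounds[of "k - 1" y]
    by (intro abs_mult_diff_le) (auto simp: pred)
  ultimately have "\<bar>weight x (k, i) - weight y (k, i)\<bar> \<le>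
      ((r * ?e) * 1 + 1 * ((4 * real N + 1) * ?e)) +
      ((r * ?e) * real N + 1 * (2 * real N * ((4 * real N + 2) * (r * ?e))))"
    unfolding weight_def by simp
  also have "\<dots> = weight_lip * ?e" by (simp only: weight_lip_def distrib_right distrib_left mult_ac mult_1)
  finally show ?thesis .
qed

lemma weight_nonneg: "0 \<le> weight x v"
  using blend_bounds lower_bounds inherited_bounds by (auto simp: weight_def split: prod.split)

lemma scale_exists:
  assumes "0 < \<delta> x" obtains k where "unit k \<le> \<delta> x" "\<delta> x < unit (k + 1)"
proof -
  let ?k = "\<lfloor>log r (\<delta> x)\<rfloor>"
  have r: "1 < r" using r_ge by simp
  have powr: "unit k = r powr of_int k" for k using r by (simp add: powr_real_of_int')
  have "r powr of_int ?k \<le> r powr log r (\<delta> x)" using r by (intro powr_mono) auto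
  moreover have "r powr log r (\<delta> x) < r powr of_int (?k + 1)" using r by (intro powr_less_mono) linarith+
  moreover have "r powr log r (\<delta> x) = \<delta> x" using r assms by simp
  ultimately show ?thesis using that[of ?k] by (simp only: powr)
qed

context
  fixes x and k
  assumes scale: "unit k \<le> \<delta> x" "\<delta> x < unit (k + 1)"
begin

lemma scale_ratio: "3 * unit (k - 1) \<le> \<delta> x" "4 * unit k \<le> unit (k + 1)"
proof -
  have "4 * unit (k - 1) \<le> unit k" "4 * unit k \<le> unit (k + 1)"
    using unit_pred[of k] unit_Suc[of k] r_ge by (simp_all add: mult_right_mono less_imp_le)
  then show "3 * unit (k - 1) \<le> \<delta> x" "4 * unit k \<le> unit (k + 1)" using scale unit_pos[of "k - 1"] by linarith+
qed

text \<open>At smaller scales the phases are completed and all mass has been passed on; at larger scales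
  they have not begun.\<close>
lemma weight_other_scales:
  assumes "m \<noteq> k" "m \<noteq> k + 1" shows "weight x (m, i) = 0"
proof (cases "m < k")
  case True
  have "unit (m - 1) \<le> unit (k - 1)" "unit (m + 1) \<le> unit k" using True by (intro unit_mono; simp)+
  moreover have "4 * unit m \<le> unit (m + 1)" using unit_Suc[of m] r_ge by (simp add: mult_right_mono less_imp_le)
  ultimately have "3 * unit (m - 1) \<le> \<delta> x" "2 * unit m \<le> \<delta> x"
    using scale scale_ratio unit_pos[of m] by linarith+
  then show ?thesis by (simp add: weight_def blend_eq_1 lower_eq_0)
next
  case False
  then have "unit (k + 1) \<le> unit (m - 1)" using assms by (intro unit_mono) simp
  then have le: "\<delta> x \<le> unit (m - 1)" using scale by linarith
  then have "\<delta> x \<le> 2 * unit (m - 1)" using unit_pos[of "m - 1"] by linarith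
  then have "blend (m - 1) x = 0" by (rule blend_eq_0)
  moreover have "upper (m - 1) j x = 0" for j using le by (simp add: upper_def lower_eq_bump)
  then have "inherited (m - 1) i x = 0" by (simp add: inherited_def sparse_sum_def)
  ultimately show ?thesis by (simp add: weight_def)
qed

lemma weight_this_scale: "weight x (k, i) = lower k i x"
  using blend_eq_1[OF scale_ratio(1)] by (simp add: weight_def)

lemma weight_next_scale: "weight x (k + 1, i) = blend k x * bump (k + 1) i x + (1 - blend k x) * inherited k i x"
  using lower_eq_bump[of x "k + 1" i] scale by (simp add: weight_def)

lemma weight_bump: assumes "weight x (m, i) \<noteq> 0" shows "m = k \<or> m = k + 1" "bump m i x \<noteq> 0"
proof -
  show m: "m = k \<or> m = k + 1" using assms weight_other_scales by blast
  show "bump m i x \<noteq> 0"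
  proof (cases "m = k")
    case True
    then show ?thesis using assms weight_this_scale lower_support by simp
  next
    case False
    then have m: "m = k + 1" using m by simp
    show ?thesis
    proof
      assume 0: "bump m i x = 0"
      then have "inherited k i x \<noteq> 0" using assms m by (auto simp: weight_next_scale)
      then obtain j where "parent k j = i" "upper k j x \<noteq> 0" by (rule inherited_support)
      then show False using bump_parent[OF upper_support] 0 m by blast
    qed
  qed
qed

text \<open>Up to \<open>\<delta> x = 2 r\<^sup>k\<close> the support lies in a simplex of the triangulated prism, which doubles one of
  at most \<open>N\<close> vertices; beyond, it lies in a simplex of the next nerve.\<close>
lemma weight_support: "finite {v. weight x v \<noteq> 0} \<and> card {v. weight x v \<noteq> 0} \<le> Suc N"
proof (cases "\<delta> x \<le> 2 * unit k")
  case True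
  let ?L = "{i. lower k i x \<noteq> 0}" and ?U = "{i. upper k i x \<noteq> 0}"
  let ?S = "(\<lambda>i. (k, i)) ` ?L \<union> (\<lambda>i. (k + 1, parent k i)) ` ?U"
  have sub: "?L \<union> ?U \<subseteq> {i. bump k i x \<noteq> 0}" using lower_support upper_support by blast
  then have fin: "finite ?L" "finite ?U" using finite_bump_support[of k x] by (auto intro: finite_subset)
  have "{v. weight x v \<noteq> 0} \<subseteq> ?S"
  proof
    fix v assume "v \<in> {v. weight x v \<noteq> 0}"
    then obtain m i where v: "v = (m, i)" and w: "weight x (m, i) \<noteq> 0" by (cases v) auto
    consider "m = k" | "m = k + 1" using weight_bump(1)[OF w] by blast
    then show "v \<in> ?S"
    proof cases
      case 1
      then show ?thesis using w v weight_this_scale by auto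
    next
      case 2
      then have "inherited k i x \<noteq> 0" using w blend_eq_0[OF True] by (auto simp: weight_next_scale)
      then obtain j where "parent k j = i" "upper k j x \<noteq> 0" by (rule inherited_support)
      then show ?thesis using 2 v by auto
    qed
  qed
  moreover have "finite ?S" using fin by simp
  moreover have "card ?S \<le> Suc N"
  proof -
    have "card ?S \<le> card ?L + card ?U"
      using fin by (intro order.trans[OF card_Un_le] add_mono card_image_le)
    also have "\<dots> = card (?L \<union> ?U) + card (?L \<inter> ?U)" using fin by (rule card_Un_Int)
    also have "card (?L \<union> ?U) \<le> card {i. bump k i x \<noteq> 0}" using sub finite_bump_support by (intro card_mono)
    also have "card {i. bump k i x \<noteq> 0} \<le> N" by (rule card_bump_support)
    also have "card (?L \<inter> ?U) \<le> 1"
    proof -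
      have "\<forall>a\<in>?L \<inter> ?U. \<forall>b\<in>?L \<inter> ?U. a = b" using at_most_one_split[of k _ x] by blast
      then show ?thesis using card_le_Suc0_iff_eq[of "?L \<inter> ?U"] fin by simp
    qed
    finally show ?thesis by simp
  qed
  ultimately show ?thesis by (intro finite_card_subset)
next
  case False
  then have l0: "lower k i x = 0" for i by (intro lower_eq_0) simp
  let ?S = "(\<lambda>i. (k + 1, i)) ` {i. bump (k + 1) i x \<noteq> 0}"
  have "{v. weight x v \<noteq> 0} \<subseteq> ?S"
  proof
    fix v assume "v \<in> {v. weight x v \<noteq> 0}"
    then obtain m i where v: "v = (m, i)" and w: "weight x (m, i) \<noteq> 0" by (cases v) auto
    have "m \<noteq> k" using w l0 weight_this_scale by auto
    then show "v \<in> ?S" using weight_bump[OF w] v by auto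
  qed
  moreover have "finite ?S" using finite_bump_support by simp
  moreover have "card ?S \<le> Suc N"
    using card_image_le[OF finite_bump_support[of "k + 1" x], of "\<lambda>i. (k + 1, i)"] card_bump_support[of "k + 1" x] by linarith
  ultimately show ?thesis by (intro finite_card_subset)
qed

text \<open>In each phase some coordinate of at least \<open>1 / 2\<close> is split between at most two
  vertices, or multiplied by a factor of at least \<open>1 / 2\<close>.\<close>
lemma weight_large: "\<exists>v. 1 / 4 \<le> weight x v"
proof -
  have "\<delta> x < 2 * unit (k + 1)" using scale unit_pos[of "k + 1"] by linarith
  then obtain i where i: "i \<in> I k" "1 / 2 \<le> bump k i x" by (rule bump_large)
  have inh: "upper k i x \<le> inherited k (parent k i) x" by (rule inherited_ge[OF i(1)])
  show ?thesis
  proof (cases "blend k x < 1 / 2")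
    case True
    show ?thesis
    proof (cases "\<delta> x \<le> 2 * unit k")
      case le: True
      have "1 / 4 \<le> lower k i x \<or> 1 / 4 \<le> upper k i x" using i by (auto simp: upper_def)
      then show ?thesis
      proof
        assume "1 / 4 \<le> lower k i x"
        then show ?thesis using weight_this_scale[of i] by (intro exI[of _ "(k, i)"]) simp
      next
        assume "1 / 4 \<le> upper k i x"
        then show ?thesis using weight_next_scale[of "parent k i"] blend_eq_0[OF le] inh
          by (intro exI[of _ "(k + 1, parent k i)"]) simp
      qed
    next
      case False
      then have "upper k i x = bump k i x" using lower_eq_0[of k x i] by (simp add: upper_def)
      then have half: "1 / 2 \<le> inherited k (parent k i) x" using inh i by linarith
      have "1 / 4 = (1 / 2) * (1 / 2 :: real)" by simp
      also have "\<dots> \<le> (1 - blend k x) * inherited k (parent k i) x"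
        using half True by (intro mult_mono) auto
      also have "\<dots> \<le> weight x (k + 1, parent k i)"
        unfolding weight_next_scale using blend_bounds bump_bounds by simp
      finally show ?thesis by blast
    qed
  next
    case False
    have "unit (k + 1) \<le> unit (k + 1 + 1)" by (intro unit_mono) simp
    then have "\<delta> x < 2 * unit (k + 1 + 1)" using scale unit_pos[of "k + 1"] by linarith
    then obtain i where i: "i \<in> I (k + 1)" "1 / 2 \<le> bump (k + 1) i x" by (rule bump_large)
    have "1 / 4 = (1 / 2) * (1 / 2 :: real)" by simp
    also have "\<dots> \<le> blend k x * bump (k + 1) i x" using i False by (intro mult_mono) auto
    also have "\<dots> \<le> weight x (k + 1, i)" unfolding weight_next_scale
      using blend_bounds[of k x] inherited_bounds[of k i x] by simp
    finally show ?thesis by blast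
  qed
qed

lemma weight_base_point:
  assumes "weight x (m, i) \<noteq> 0"
  shows "p m i \<in> Z" "dist x (p m i) \<le> 4 * r ^ 3 * \<delta> x"
proof -
  have b: "bump m i x \<noteq> 0" using weight_bump[OF assms] by blast
  then have "i \<in> I m" by (simp add: bump_near)
  then show "p m i \<in> Z" using base_point covers[of m] by blast
  have "m + 1 \<le> k + 1 + 1" using weight_bump(1)[OF assms] by auto
  then have "unit (m + 1) \<le> unit (k + 1 + 1)" by (rule unit_mono)
  also have "\<dots> = r * (r * unit k)" by (simp only: unit_Suc)
  also have "\<dots> \<le> r * (r * \<delta> x)" using scale r_ge by (intro mult_left_mono) auto
  finally have "4 * r * unit (m + 1) \<le> 4 * r * (r * (r * \<delta> x))" using r_ge by (intro mult_left_mono) auto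
  then show "dist x (p m i) \<le> 4 * r ^ 3 * \<delta> x"
    using bump_dist[OF b] by (simp add: power3_eq_cube mult_ac)
qed

text \<open>The vertices in the support of \<open>x\<close> live at scales comparable to \<open>\<delta> x\<close>; this turns the global bound into a
  Lipschitz constant inversely proportional to \<open>\<delta> x\<close>.\<close>
lemma weight_local_lipschitz:
  assumes "weight x (m, i) \<noteq> 0"
  shows "\<bar>weight x (m, i) - weight y (m, i)\<bar> * \<delta> x \<le> weight_lip * r * dist x y"
proof -
  have "unit k \<le> unit m" using weight_bump(1)[OF assms] by (intro unit_mono) auto
  then have "r * unit k \<le> r * unit m" using r_ge by (intro mult_left_mono) auto
  then have \<delta>: "\<delta> x \<le> r * unit m" using scale unit_Suc[of k] by linarith
  have "\<bar>weight x (m, i) - weight y (m, i)\<bar> * \<delta> x \<le> (weight_lip * (dist x y / unit m)) * (r * unit m)"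
    using weight_lip_nonneg unit_pos[of m]
    by (intro mult_mono weight_lipschitz \<delta>) (auto simp: infdist_nonneg less_imp_le)
  also have "\<dots> = weight_lip * r * dist x y" using unit_pos[of m] by simp
  finally show ?thesis .
qed

end

end

lemma diameter_le_dist:
  assumes "0 \<le> D" "\<And>x y. x \<in> A \<Longrightarrow> y \<in> A \<Longrightarrow> dist x y \<le> D"
  shows "diameter A \<le> D"
  unfolding diameter_def using assms by (auto intro!: cSUP_least)

lemma strict_linear_order_exists: "\<exists>R :: ('i \<times> 'i) set. trans R \<and> irrefl R \<and> total R"
proof -
  obtain w :: "('i \<times> 'i) set" where "well_order_on UNIV w" using well_order_on by blast
  then have w: "trans w" "antisym w" "total w"
    by (auto simp: well_order_on_def linear_order_on_def partial_order_on_def preorder_on_def)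
  have "trans (w - Id)" using w(1,2) by (rule trans_diff_Id)
  moreover have "irrefl (w - Id)" by (simp add: irrefl_def)
  moreover have "total (w - Id)" using w(3) by (auto simp: total_on_def)
  ultimately show ?thesis by blast
qed

text \<open>The map from the complement of \<open>Z\<close> to the telescope, with a label \<open>q v\<close> in \<open>Z\<close> for each vertex \<open>v\<close>: at most
  \<open>N + 1\<close> vertices carry \<open>x\<close>, and at \<open>x\<close> everything happens at the scale of the distance to \<open>Z\<close>.\<close>
lemma nagata_whitney_weights:
  fixes Z :: "'a::metric_space set"
  assumes Z: "Z \<noteq> {}" and dim: "nagata_dim Z \<le> ereal (of_int n)" and N: "N = nat (n + 1)"
  obtains K and \<mu> :: "'a \<Rightarrow> int \<times> 'a set \<Rightarrow> real" and q where "0 \<le> K"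
    and "\<And>x v. 0 \<le> \<mu> x v"
    and "\<And>x. 0 < infdist x Z \<Longrightarrow> finite {v. \<mu> x v \<noteq> 0} \<and> card {v. \<mu> x v \<noteq> 0} \<le> Suc N"
    and "\<And>x. 0 < infdist x Z \<Longrightarrow> \<exists>v. 1 / 4 \<le> \<mu> x v"
    and "\<And>x y v. 0 < infdist x Z \<Longrightarrow> \<mu> x v \<noteq> 0 \<Longrightarrow> \<bar>\<mu> x v - \<mu> y v\<bar> * infdist x Z \<le> K * dist x y"
    and "\<And>x v. 0 < infdist x Z \<Longrightarrow> \<mu> x v \<noteq> 0 \<Longrightarrow> q v \<in> Z \<and> dist x (q v) \<le> K * infdist x Z"
proof -
  obtain c where c: "0 < c"
    and cov: "\<And>s. 0 < s \<Longrightarrow> \<exists>(I :: 'a set set) B. (\<Union>i\<in>I. B i) = Z \<and>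
          (\<forall>i\<in>I. B i \<noteq> {} \<and> (\<forall>x\<in>B i. \<forall>y\<in>B i. dist x y \<le> c * s)) \<and>
          (\<forall>A\<subseteq>Z. diam_at_most A s \<longrightarrow>
             finite {i\<in>I. B i \<inter> A \<noteq> {}} \<and> card {i\<in>I. B i \<inter> A \<noteq> {}} \<le> N)"
    using dim unfolding N by (rule nagata_dim_coveringE) blast
  define r where "r = 4 + 2 * c"
  have u: "0 < r powi k" for k using c by (intro zero_less_power_int) (simp add: r_def)
  define s where "s k = 8 * r powi (k + 1)" for k
  have s: "0 < s k" for k using u by (simp add: s_def)
  have "\<forall>k. \<exists>(I :: 'a set set) B. (\<Union>i\<in>I. B i) = Z \<and>
          (\<forall>i\<in>I. B i \<noteq> {} \<and> (\<forall>x\<in>B i. \<forall>y\<in>B i. dist x y \<le> c * s k)) \<and>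
          (\<forall>A\<subseteq>Z. diam_at_most A (s k) \<longrightarrow>
             finite {i\<in>I. B i \<inter> A \<noteq> {}} \<and> card {i\<in>I. B i \<inter> A \<noteq> {}} \<le> N)"
    using cov[OF s] by blast
  then obtain I :: "int \<Rightarrow> 'a set set" and B where IB: "\<forall>k. (\<Union>i\<in>I k. B k i) = Z \<and>
          (\<forall>i\<in>I k. B k i \<noteq> {} \<and> (\<forall>x\<in>B k i. \<forall>y\<in>B k i. dist x y \<le> c * s k)) \<and>
          (\<forall>A\<subseteq>Z. diam_at_most A (s k) \<longrightarrow>
             finite {i\<in>I k. B k i \<inter> A \<noteq> {}} \<and> card {i\<in>I k. B k i \<inter> A \<noteq> {}} \<le> N)"
    unfolding choice_iff by blast
  have cover: "(\<Union>i\<in>I k. B k i) = Z" for k using IB by (elim allE[of _ k] conjE)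
  have cells: "\<forall>i\<in>I k. B k i \<noteq> {} \<and> (\<forall>x\<in>B k i. \<forall>y\<in>B k i. dist x y \<le> c * s k)" for k
    using IB by (elim allE[of _ k] conjE)
  have mult: "\<forall>A\<subseteq>Z. diam_at_most A (s k) \<longrightarrow>
             finite {i\<in>I k. B k i \<inter> A \<noteq> {}} \<and> card {i\<in>I k. B k i \<inter> A \<noteq> {}} \<le> N" for k
    using IB by (elim allE[of _ k] conjE)
  define p where "p k i = (SOME x. x \<in> B k i)" for k i
  obtain R :: "('a set \<times> 'a set) set" where R: "trans R" "irrefl R" "total R"
    using strict_linear_order_exists by blast
  have near: "finite {i \<in> I k. infdist x (B k i) < 4 * r powi (k + 1)} \<and>
      card {i \<in> I k. infdist x (B k i) < 4 * r powi (k + 1)} \<le> N" for k x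
  proof -
    let ?w = "4 * r powi (k + 1)"
    \<comment> \<open>Members near \<open>x\<close> all meet this set, whose diameter is at most the scale of the covering.\<close>
    let ?A = "{b \<in> Z. dist x b < ?w}"
    have "dist a b \<le> s k" if "a \<in> ?A" "b \<in> ?A" for a b
      using that dist_triangle3[of a b x] by (simp add: s_def)
    moreover have "?A \<subseteq> ball x ?w" by auto
    then have "bounded ?A" by (rule bounded_subset[OF bounded_ball])
    ultimately have "diam_at_most ?A (s k)"
      using s[of k] by (auto simp: diam_at_most_def intro!: diameter_le_dist)
    then have A: "finite {i\<in>I k. B k i \<inter> ?A \<noteq> {}} \<and> card {i\<in>I k. B k i \<inter> ?A \<noteq> {}} \<le> N"
      using mult[of k, rule_format, of ?A] by simp
    have "{i \<in> I k. infdist x (B k i) < ?w} \<subseteq> {i\<in>I k. B k i \<inter> ?A \<noteq> {}}"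
    proof clarify
      fix i assume i: "i \<in> I k" "infdist x (B k i) < ?w" "B k i \<inter> ?A = {}"
      have ne: "B k i \<noteq> {}" using cells i by blast
      then obtain b where "b \<in> B k i" "dist x b < ?w" using infdist_lessE i by blast
      moreover have "B k i \<subseteq> Z" using cover[of k] i by blast
      ultimately show False using i by blast
    qed
    then show ?thesis using A by (meson card_mono finite_subset order.trans)
  qed
  interpret scaled_covers Z N c r I B p R
  proof
    fix k i x y
    show "(\<Union>i\<in>I k. B k i) = Z" by (rule cover)
    show "p k i \<in> B k i" if "i \<in> I k"
    proof -
      have "\<exists>x. x \<in> B k i" using cells that by blast
      then show ?thesis unfolding p_def by (rule someI_ex)
    qed
    show "dist x y \<le> 8 * c * r powi (k + 1)" if "i \<in> I k" "x \<in> B k i" "y \<in> B k i"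
    proof -
      have "dist x y \<le> c * s k" using cells that by blast
      then show ?thesis by (simp add: s_def mult_ac)
    qed
  qed (use c r_def Z near R in auto)
  have r0: "0 \<le> r" using r_ge by simp
  show ?thesis
  proof (rule that[of "weight_lip * r + 4 * r ^ 3" weight "\<lambda>(k, i). p k i"])
    show "0 \<le> weight_lip * r + 4 * r ^ 3" using weight_lip_nonneg r0 by simp
    show "0 \<le> weight x v" for x v by (rule weight_nonneg)
    fix x assume "0 < infdist x Z"
    then obtain k where k: "r powi k \<le> infdist x Z" "infdist x Z < r powi (k + 1)" by (rule scale_exists)
    show "finite {v. weight x v \<noteq> 0} \<and> card {v. weight x v \<noteq> 0} \<le> Suc N" by (rule weight_support[OF k])
    show "\<exists>v. 1 / 4 \<le> weight x v" by (rule weight_large[OF k])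
    fix v assume v: "weight x v \<noteq> 0"
    obtain m i where mi: "v = (m, i)" by (cases v)
    show "\<bar>weight x v - weight y v\<bar> * infdist x Z \<le> (weight_lip * r + 4 * r ^ 3) * dist x y" for y
    proof -
      have "\<bar>weight x v - weight y v\<bar> * infdist x Z \<le> weight_lip * r * dist x y"
        using weight_local_lipschitz[OF k, of m i y] v mi by simp
      also have "\<dots> \<le> (weight_lip * r + 4 * r ^ 3) * dist x y" using r0 by (intro mult_right_mono) auto
      finally show ?thesis .
    qed
    have "dist x (p m i) \<le> 4 * r ^ 3 * infdist x Z" using weight_base_point[OF k, of m i] v mi by simp
    also have "\<dots> \<le> (weight_lip * r + 4 * r ^ 3) * infdist x Z"
      using r0 weight_lip_nonneg by (intro mult_right_mono infdist_nonneg) simp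
    finally show "(case v of (k, i) \<Rightarrow> p k i) \<in> Z \<and>
        dist x (case v of (k, i) \<Rightarrow> p k i) \<le> (weight_lip * r + 4 * r ^ 3) * infdist x Z"
      using weight_base_point[OF k, of m i] v mi by simp
  qed
qed

section \<open>Extension across Whitney scales\<close>

text \<open>Two points that are farther apart than a fixed fraction of the distance of one of them to \<open>Z\<close> are
  compared through a point of \<open>Z\<close> close to that one, at the cost of a constant factor.\<close>
lemma lipschitz_from_whitney_scale:
  fixes g :: "'a::metric_space \<Rightarrow> 'b::metric_space"
  assumes Z: "closed Z" "Z \<noteq> {}" and A: "0 \<le> A" and \<beta>: "0 < \<beta>"
    and onZ: "\<And>z z'. z \<in> Z \<Longrightarrow> z' \<in> Z \<Longrightarrow> dist (g z) (g z') \<le> A * dist z z'"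
    and toZ: "\<And>x z. x \<notin> Z \<Longrightarrow> z \<in> Z \<Longrightarrow> dist (g x) (g z) \<le> A * dist x z"
    and loc: "\<And>x y. x \<notin> Z \<Longrightarrow> y \<notin> Z \<Longrightarrow> dist x y \<le> \<beta> * infdist x Z \<Longrightarrow> dist (g x) (g y) \<le> A * dist x y"
  shows "\<exists>L. L-lipschitz_on UNIV g"
proof (intro exI[of _ "A * (4 / \<beta> + 1)"] lipschitz_onI)
  have A': "A * d \<le> A * (4 / \<beta> + 1) * d" if "0 \<le> d" for d
    using A \<beta> that by (simp add: distrib_left distrib_right)
  fix x y :: 'a
  show "dist (g x) (g y) \<le> A * (4 / \<beta> + 1) * dist x y"
  proof (cases "x \<in> Z \<or> y \<in> Z \<or> dist x y \<le> \<beta> * infdist x Z")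
    case True
    then have "dist (g x) (g y) \<le> A * dist x y"
      using onZ[of x y] toZ[of x y] toZ[of y x] loc[of x y] by (auto simp: dist_commute)
    then show ?thesis using A'[of "dist x y"] by simp
  next
    case False
    then have "0 < infdist x Z" using Z infdist_pos_not_in_closed by blast
    then have "infdist x Z < 2 * infdist x Z" by simp
    then obtain z where z: "z \<in> Z" "dist x z < 2 * infdist x Z" using infdist_lessE[OF Z(2)] by blast
    have "infdist x Z \<le> dist x y / \<beta>" using False \<beta> by (simp add: field_simps)
    then have xz: "dist x z \<le> 2 * (dist x y / \<beta>)" using z by linarith
    have "dist (g x) (g y) \<le> dist (g x) (g z) + dist (g y) (g z)" by (rule dist_triangle2)
    also have "\<dots> \<le> A * dist x z + A * dist y z" using toZ False z by (intro add_mono) auto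
    also have "\<dots> = A * (dist x z + dist y z)" by (simp add: distrib_left)
    also have "\<dots> \<le> A * (4 * (dist x y / \<beta>) + dist x y)"
      using xz dist_triangle3[of y z x] by (intro mult_left_mono A) (simp add: dist_commute)
    also have "\<dots> = A * (4 / \<beta> + 1) * dist x y" by (simp add: algebra_simps)
    finally show ?thesis .
  qed
qed (use A \<beta> in simp)

text \<open>Weights of at most \<open>1 / 8\<close> are set to 0, and the others are scaled to sum 1. The threshold is half of the
  value \<open>1 / 4\<close> that some weight is known to attain, so that the total is at least \<open>1 / 8\<close>.\<close>
definition truncate_normalize :: "('i \<Rightarrow> real) \<Rightarrow> 'i \<Rightarrow> real" where
  "truncate_normalize u v = max 0 (u v - 1 / 8) / (\<Sum>w | u w \<noteq> 0. max 0 (u w - 1 / 8))"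

lemma truncated_mass:
  fixes u :: "'i \<Rightarrow> real"
  assumes "\<And>v. v \<notin> J \<Longrightarrow> u v \<le> 1 / 8" "finite J" "finite {v. u v \<noteq> 0}"
  shows "(\<Sum>w | u w \<noteq> 0. max 0 (u w - 1 / 8)) = (\<Sum>w\<in>J. max 0 (u w - 1 / 8))"
proof (rule sum.mono_neutral_cong)
  show "max 0 (u v - 1 / 8) = 0" if "v \<in> {v. u v \<noteq> 0} - J" for v
    using assms(1)[of v] that by simp
qed (use assms in auto)

lemma truncated_mass_ge:
  fixes u :: "'i \<Rightarrow> real"
  assumes "\<And>v. v \<notin> J \<Longrightarrow> u v \<le> 1 / 8" "finite J" "1 / 4 \<le> u a"
  shows "1 / 8 \<le> (\<Sum>w\<in>J. max 0 (u w - 1 / 8))"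
proof -
  have "a \<in> J" using assms(1)[of a] assms(3) by linarith
  have "1 / 8 \<le> max 0 (u a - 1 / 8)" using assms(3) by simp
  also have "\<dots> \<le> (\<Sum>w\<in>J. max 0 (u w - 1 / 8))" using \<open>a \<in> J\<close> assms(2) by (intro member_le_sum) auto
  finally show ?thesis .
qed

lemma truncate_normalize_simplex:
  fixes u :: "'i \<Rightarrow> real"
  assumes J: "\<And>v. v \<notin> J \<Longrightarrow> u v \<le> 1 / 8" "finite J" "finite {v. u v \<noteq> 0}" and a: "1 / 4 \<le> u a"
  shows "truncate_normalize u \<in> std_simplex J"
proof -
  let ?T = "\<Sum>w\<in>J. max 0 (u w - 1 / 8)"
  have T: "1 / 8 \<le> ?T" by (rule truncated_mass_ge[of J u a, OF J(1,2) a])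
  have "(\<Sum>w | u w \<noteq> 0. max 0 (u w - 1 / 8)) = ?T" by (rule truncated_mass[of J u, OF J])
  then have tn: "truncate_normalize u v = max 0 (u v - 1 / 8) / ?T" for v
    by (simp only: truncate_normalize_def)
  have "sum (truncate_normalize u) J = ?T / ?T" unfolding tn by (rule sum_divide_distrib[symmetric])
  then show ?thesis using T J(1) by (auto simp: std_simplex_def tn)
qed

text \<open>The set \<open>J\<close> has to contain only the indices whose weights exceed the threshold. For weights of two
  nearby points it can therefore be the support of one of them, and both truncations
  lie in the same simplex.\<close>
lemma truncate_normalize_lipschitz:
  fixes u u' :: "'i \<Rightarrow> real"
  assumes u: "\<And>v. v \<notin> J \<Longrightarrow> u v \<le> 1 / 8" "finite {v. u v \<noteq> 0}" "1 / 4 \<le> u a"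
    and u': "\<And>v. v \<notin> J \<Longrightarrow> u' v \<le> 1 / 8" "finite {v. u' v \<noteq> 0}" "1 / 4 \<le> u' a'"
    and J: "finite J" and e: "\<And>v. v \<in> J \<Longrightarrow> \<bar>u v - u' v\<bar> \<le> e"
  shows "l1_dist J (truncate_normalize u) (truncate_normalize u') \<le> 16 * real (card J) * e"
proof -
  let ?t = "\<lambda>u v. max 0 (u v - 1 / 8 :: real)"
  define T where "T = sum (?t u) J"
  define T' where "T' = sum (?t u') J"
  have T: "1 / 8 \<le> T" unfolding T_def by (rule truncated_mass_ge[of J u a, OF u(1) J u(3)])
  have T': "1 / 8 \<le> T'" unfolding T'_def by (rule truncated_mass_ge[of J u' a', OF u'(1) J u'(3)])
  have "sum (?t u) {w. u w \<noteq> 0} = T" unfolding T_def by (rule truncated_mass[of J u, OF u(1) J u(2)])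
  then have tn: "truncate_normalize u v = ?t u v / T" for v by (simp only: truncate_normalize_def)
  have "sum (?t u') {w. u' w \<noteq> 0} = T'" unfolding T'_def by (rule truncated_mass[of J u', OF u'(1) J u'(2)])
  then have tn': "truncate_normalize u' v = ?t u' v / T'" for v by (simp only: truncate_normalize_def)
  have d: "\<bar>?t u v - ?t u' v\<bar> \<le> e" if "v \<in> J" for v using e[OF that] by linarith
  have "\<bar>T - T'\<bar> \<le> (\<Sum>v\<in>J. \<bar>?t u v - ?t u' v\<bar>)"
    unfolding T_def T'_def sum_subtractf[symmetric] by (rule sum_abs)
  also have sd: "\<dots> \<le> real (card J) * e" using d by (intro sum_bounded_above) auto
  finally have TT: "\<bar>T - T'\<bar> \<le> real (card J) * e" .
  have step: "\<bar>?t u v / T - ?t u' v / T'\<bar> \<le> 8 * \<bar>?t u v - ?t u' v\<bar> + ?t u' v / T' * (8 * (real (card J) * e))" for v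
  proof -
    have "a / T - b / T' = (a - b) * (1 / T) + b / T' * ((T' - T) * (1 / T))" for a b
      using T T' by (simp add: field_simps)
    then have "\<bar>?t u v / T - ?t u' v / T'\<bar> = \<bar>(?t u v - ?t u' v) * (1 / T) + ?t u' v / T' * ((T' - T) * (1 / T))\<bar>"
      by simp
    also have "\<dots> \<le> \<bar>?t u v - ?t u' v\<bar> * (1 / T) + ?t u' v / T' * (\<bar>T' - T\<bar> * (1 / T))"
      using T T' by (intro order.trans[OF abs_triangle_ineq]) (simp add: abs_mult)
    also have "\<dots> \<le> \<bar>?t u v - ?t u' v\<bar> * 8 + ?t u' v / T' * ((real (card J) * e) * 8)"
      using T T' TT by (intro add_mono mult_mono mult_left_mono) (auto simp: field_simps abs_minus_commute)
    finally show ?thesis by (simp add: mult_ac)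
  qed
  have sum1: "(\<Sum>v\<in>J. ?t u' v / T') = 1" using T' by (simp add: sum_divide_distrib[symmetric] T'_def)
  have "l1_dist J (truncate_normalize u) (truncate_normalize u') = (\<Sum>v\<in>J. \<bar>?t u v / T - ?t u' v / T'\<bar>)"
    by (simp only: l1_dist_def tn tn')
  also have "\<dots> \<le> (\<Sum>v\<in>J. 8 * \<bar>?t u v - ?t u' v\<bar> + ?t u' v / T' * (8 * (real (card J) * e)))"
    by (intro sum_mono step)
  also have "\<dots> = 8 * (\<Sum>v\<in>J. \<bar>?t u v - ?t u' v\<bar>) + 8 * (real (card J) * e)"
    by (simp only: sum.distrib sum_distrib_left[symmetric] sum_distrib_right[symmetric] sum1 mult_1)
  also have "\<dots> \<le> 16 * real (card J) * e" unfolding mult.assoc using sd by linarith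
  finally show ?thesis .
qed

lemma l1_dist_simplex_le:
  assumes "finite J" "u \<in> std_simplex J" "v \<in> std_simplex J" shows "l1_dist J u v \<le> 2"
proof -
  have "l1_dist J u v \<le> (\<Sum>i\<in>J. u i + v i)" unfolding l1_dist_def
    using assms by (intro sum_mono) (auto simp: std_simplex_def abs_le_iff add_increasing add_increasing2)
  also have "\<dots> = 2" using assms by (simp add: sum.distrib std_simplex_def)
  finally show ?thesis .
qed

theorem theorem5p1:
  fixes Z :: "'a::metric_space set"
    and f :: "'a \<Rightarrow> 'b::metric_space"
    and n :: int
  assumes "closed Z"
    and "nagata_dim Z \<le> ereal (of_int n)"
    and "\<exists>L. L-lipschitz_on Z f"
    and "\<forall>m::nat. int m \<le> n \<longrightarrow> Lipschitz_connected m (euclidean_metric :: 'b metric)"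
  shows "\<exists>g :: 'a \<Rightarrow> 'b. (\<exists>L. L-lipschitz_on UNIV g) \<and> (\<forall>z\<in>Z. g z = f z)"
proof (cases "Z = {}")
  case True
  have "0-lipschitz_on UNIV (\<lambda>_::'a. undefined :: 'b)" by (rule lipschitz_onI) auto
  then show ?thesis using True by blast
next
  case False
  define N where "N = nat (n + 1)"
  have "Lipschitz_connected m (euclidean_metric :: 'b metric)" if "m < N" for m
    using assms(4) that unfolding N_def by auto
  from skeleton_extension[of N, OF this, where 'i = "int \<times> 'a set"] obtain C where C: "0 \<le> C"
    and ext: "\<forall>y :: int \<times> 'a set \<Rightarrow> 'b. \<exists>F. (\<forall>i. F (\<lambda>j. if j = i then 1 else 0) = y i) \<and>
    (\<forall>J. finite J \<longrightarrow> card J \<le> Suc N \<longrightarrow>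
      (\<forall>u\<in>std_simplex J. \<forall>v\<in>std_simplex J. dist (F u) (F v) \<le> C * diameter (y ` J) * l1_dist J u v))"
    by blast
  obtain L where L: "L-lipschitz_on Z f" using assms(3) by blast
  have L0: "0 \<le> L" using L by (rule lipschitz_on_nonneg)
  obtain K \<mu> and q :: "int \<times> 'a set \<Rightarrow> 'a" where K: "0 \<le> K"
    and \<mu>0: "\<And>x v. 0 \<le> \<mu> x v"
    and \<mu>_supp: "\<And>x. 0 < infdist x Z \<Longrightarrow> finite {v. \<mu> x v \<noteq> 0} \<and> card {v. \<mu> x v \<noteq> 0} \<le> Suc N"
    and \<mu>_large: "\<And>x. 0 < infdist x Z \<Longrightarrow> \<exists>v. 1 / 4 \<le> \<mu> x v"
    and \<mu>_lip: "\<And>x y v. 0 < infdist x Z \<Longrightarrow> \<mu> x v \<noteq> 0 \<Longrightarrow> \<bar>\<mu> x v - \<mu> y v\<bar> * infdist x Z \<le> K * dist x y"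
    and q: "\<And>x v. 0 < infdist x Z \<Longrightarrow> \<mu> x v \<noteq> 0 \<Longrightarrow> q v \<in> Z \<and> dist x (q v) \<le> K * infdist x Z"
    by (rule nagata_whitney_weights[OF False assms(2) N_def]) (rule that; assumption)
  from ext[rule_format, of "\<lambda>v. f (q v)"] obtain F where
    F: "(\<forall>i. F (\<lambda>j. if j = i then 1 else 0) = f (q i)) \<and>
    (\<forall>J. finite J \<longrightarrow> card J \<le> Suc N \<longrightarrow>
      (\<forall>u\<in>std_simplex J. \<forall>v\<in>std_simplex J. dist (F u) (F v) \<le> C * diameter ((\<lambda>v. f (q v)) ` J) * l1_dist J u v))"
    by (rule exE)
  define J where "J x = {v. \<mu> x v \<noteq> 0}" for x
  define l where "l x = truncate_normalize (\<mu> x)" for x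
  define g where "g x = (if x \<in> Z then f x else F (l x))" for x
  have pos: "0 < infdist x Z" if "x \<notin> Z" for x
    using that infdist_pos_not_in_closed[OF assms(1) False] by blast
  have Jfin: "finite (J x)" "card (J x) \<le> Suc N" if "x \<notin> Z" for x
    using \<mu>_supp[OF pos[OF that]] by (auto simp: J_def)
  have Jout: "\<mu> x v \<le> 1 / 8" if "v \<notin> J x" for x v using that by (simp add: J_def)
  have l_in: "l x \<in> std_simplex (J x)" if x: "x \<notin> Z" for x
  proof -
    obtain a where "1 / 4 \<le> \<mu> x a" using \<mu>_large[OF pos[OF x]] by blast
    then show ?thesis unfolding l_def using Jfin[OF x] Jout
      by (intro truncate_normalize_simplex) (auto simp: J_def)
  qed
  have fq: "dist (f (q v)) (f (q w)) \<le> 2 * L * K * infdist x Z" if "x \<notin> Z" "v \<in> J x" "w \<in> J x" for x v w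
  proof -
    have v: "q v \<in> Z" "dist x (q v) \<le> K * infdist x Z" and w: "q w \<in> Z" "dist x (q w) \<le> K * infdist x Z"
      using q[OF pos[OF that(1)]] that by (auto simp: J_def)
    have d: "dist (q v) (q w) \<le> 2 * (K * infdist x Z)" using v w dist_triangle3[of "q v" "q w" x] by linarith
    have "dist (f (q v)) (f (q w)) \<le> L * dist (q v) (q w)" by (rule lipschitz_onD[OF L v(1) w(1)])
    also have "\<dots> \<le> L * (2 * (K * infdist x Z))" by (rule mult_left_mono[OF d L0])
    finally show ?thesis by (simp add: mult_ac)
  qed
  have F_lip: "dist (F s) (F t) \<le> C * (2 * L * K * infdist x Z) * l1_dist (J x) s t"
    if x: "x \<notin> Z" and "s \<in> std_simplex (J x)" "t \<in> std_simplex (J x)" for x s t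
  proof -
    have "0 \<le> 2 * L * K * infdist x Z" using L0 K by (simp add: infdist_nonneg)
    then have diam: "diameter ((\<lambda>v. f (q v)) ` J x) \<le> 2 * L * K * infdist x Z"
      using fq[OF x] by (auto intro!: diameter_le_dist)
    have "dist (F s) (F t) \<le> C * diameter ((\<lambda>v. f (q v)) ` J x) * l1_dist (J x) s t"
      using F Jfin[OF x] that by blast
    also have "\<dots> \<le> C * (2 * L * K * infdist x Z) * l1_dist (J x) s t"
      by (rule mult_right_mono[OF mult_left_mono[OF diam C] l1_dist_nonneg])
    finally show ?thesis .
  qed
  \<comment> \<open>The factor 16 makes weights vary by at most \<open>1 / 8\<close>, the truncation threshold, over
      distances up to \<open>\<beta>\<close> times the distance to \<open>Z\<close>.\<close>
  define \<beta> where "\<beta> = 1 / (16 * (K + 1))"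
  have \<beta>: "0 < \<beta>" "\<beta> \<le> 1 / 2" "2 * K * \<beta> \<le> 1 / 8" using K by (auto simp: \<beta>_def field_simps)
  define A where "A = L + (4 * C * L * K + L * (K + 1)) + C * (2 * L * K) * (16 * real (Suc N) * K)"
  have parts: "0 \<le> 4 * C * L * K + L * (K + 1)" "0 \<le> C * (2 * L * K) * (16 * real (Suc N) * K)" using C K L0 by auto
  have "\<exists>L. L-lipschitz_on UNIV g"
  proof (rule lipschitz_from_whitney_scale[OF assms(1) False _ \<beta>(1)])
    show "0 \<le> A" using parts L0 by (simp add: A_def)
  next
    fix z z' assume z: "z \<in> Z" "z' \<in> Z"
    then have "dist (g z) (g z') \<le> L * dist z z'" using lipschitz_onD[OF L] by (simp add: g_def)
    also have "\<dots> \<le> A * dist z z'" using parts unfolding A_def by (intro mult_right_mono zero_le_dist) linarith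
    finally show "dist (g z) (g z') \<le> A * dist z z'" .
  next
    fix x z assume x: "x \<notin> Z" and z: "z \<in> Z"
    let ?d = "dist x z"
    obtain a where a: "1 / 4 \<le> \<mu> x a" using \<mu>_large[OF pos[OF x]] by blast
    then have aJ: "a \<in> J x" by (auto simp: J_def)
    have qa: "q a \<in> Z" "dist x (q a) \<le> K * infdist x Z" using q[OF pos[OF x]] aJ by (auto simp: J_def)
    have \<delta>: "infdist x Z \<le> ?d" by (rule infdist_le[OF z])
    let ?e = "\<lambda>j. if j = a then 1 else (0::real)"
    have e: "?e \<in> std_simplex (J x)" by (rule vertex_in_std_simplex[OF Jfin(1)[OF x] aJ])
    have "F ?e = f (q a)" using F by blast
    then have "dist (g x) (f (q a)) = dist (F (l x)) (F ?e)" using x by (simp only: g_def if_False)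
    also have "\<dots> \<le> C * (2 * L * K * infdist x Z) * l1_dist (J x) (l x) ?e"
      by (rule F_lip[OF x l_in[OF x] e])
    also have "\<dots> \<le> C * (2 * L * K * ?d) * 2"
      using C L0 K \<delta> by (intro mult_mono l1_dist_simplex_le Jfin x l_in e l1_dist_nonneg) (auto simp: infdist_nonneg)
    finally have 1: "dist (g x) (f (q a)) \<le> 4 * C * L * K * ?d" by (simp add: mult_ac)
    have "K * infdist x Z \<le> K * ?d" using \<delta> K by (rule mult_left_mono)
    then have "dist (q a) z \<le> (K + 1) * ?d" using qa dist_triangle3[of "q a" z x] by (simp add: distrib_right)
    then have "L * dist (q a) z \<le> L * ((K + 1) * ?d)" using L0 by (rule mult_left_mono)
    then have 2: "dist (f (q a)) (f z) \<le> L * (K + 1) * ?d"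
      using lipschitz_onD[OF L qa(1) z] by (simp add: mult.assoc)
    have "dist (g x) (g z) \<le> dist (g x) (f (q a)) + dist (f (q a)) (f z)"
      using z by (simp add: g_def dist_triangle)
    also have "\<dots> \<le> (4 * C * L * K + L * (K + 1)) * ?d" using 1 2 by (simp only: distrib_right)
    also have "\<dots> \<le> A * ?d" using parts L0 unfolding A_def by (intro mult_right_mono zero_le_dist) linarith
    finally show "dist (g x) (g z) \<le> A * ?d" .
  next
    fix x y assume x: "x \<notin> Z" and y: "y \<notin> Z" and close: "dist x y \<le> \<beta> * infdist x Z"
    let ?\<delta> = "infdist x Z"
    have dx: "0 < ?\<delta>" and dy: "0 < infdist y Z" using pos x y by auto
    have "\<beta> * ?\<delta> \<le> 1 / 2 * ?\<delta>" using \<beta> dx by (intro mult_right_mono) auto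
    then have half: "?\<delta> / 2 \<le> infdist y Z" using close infdist_triangle[of x Z y] by linarith
    \<comment> \<open>Weights outside the support of \<open>x\<close> are small at \<open>y\<close>, because they vanish at \<open>x\<close>.\<close>
    have Jy: "\<mu> y v \<le> 1 / 8" if v: "v \<notin> J x" for v
    proof (cases "\<mu> y v = 0")
      case False
      have "\<mu> y v * (?\<delta> / 2) \<le> \<mu> y v * infdist y Z" by (intro mult_left_mono half \<mu>0)
      also have "\<dots> \<le> K * dist x y" using \<mu>_lip[OF dy False, of x] v \<mu>0[of y v] by (simp add: J_def dist_commute)
      also have "\<dots> \<le> K * (\<beta> * ?\<delta>)" using close K by (rule mult_left_mono)
      finally have "\<mu> y v * ?\<delta> \<le> (2 * K * \<beta>) * ?\<delta>" by simp
      then have "\<mu> y v \<le> 2 * K * \<beta>" using dx by simp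
      then show ?thesis using \<beta> by linarith
    qed simp
    obtain a where a: "1 / 4 \<le> \<mu> x a" using \<mu>_large[OF dx] by blast
    obtain b where b: "1 / 4 \<le> \<mu> y b" using \<mu>_large[OF dy] by blast
    have fins: "finite {v. \<mu> x v \<noteq> 0}" "finite {v. \<mu> y v \<noteq> 0}" using \<mu>_supp dx dy by auto
    have ly: "l y \<in> std_simplex (J x)" unfolding l_def
      by (rule truncate_normalize_simplex[of "J x" "\<mu> y" b, OF Jy Jfin(1)[OF x] fins(2) b])
    have "l1_dist (J x) (l x) (l y) \<le> 16 * real (card (J x)) * (K * dist x y / ?\<delta>)"
      unfolding l_def
    proof (rule truncate_normalize_lipschitz[of "J x" "\<mu> x" a "\<mu> y" b, OF Jout fins(1) a Jy fins(2) b Jfin(1)[OF x]])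
      fix v assume "v \<in> J x"
      then show "\<bar>\<mu> x v - \<mu> y v\<bar> \<le> K * dist x y / ?\<delta>"
        using \<mu>_lip[OF dx, of v y] dx by (simp add: J_def pos_le_divide_eq)
    qed
    also have "\<dots> \<le> 16 * real (Suc N) * (K * dist x y / ?\<delta>)"
      using Jfin(2)[OF x] K dx by (intro mult_right_mono mult_left_mono) auto
    finally have l1: "l1_dist (J x) (l x) (l y) \<le> 16 * real (Suc N) * (K * dist x y / ?\<delta>)" .
    have "dist (g x) (g y) = dist (F (l x)) (F (l y))" using x y by (simp add: g_def)
    also have "\<dots> \<le> C * (2 * L * K * ?\<delta>) * l1_dist (J x) (l x) (l y)" by (rule F_lip[OF x l_in[OF x] ly])
    also have "\<dots> \<le> C * (2 * L * K * ?\<delta>) * (16 * real (Suc N) * (K * dist x y / ?\<delta>))"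
      using C L0 K dx by (intro mult_left_mono l1) auto
    also have "\<dots> = C * (2 * L * K) * (16 * real (Suc N) * K) * dist x y" using dx by simp
    also have "\<dots> \<le> A * dist x y" using parts L0 unfolding A_def by (intro mult_right_mono zero_le_dist) linarith
    finally show "dist (g x) (g y) \<le> A * dist x y" .
  qed
  moreover have "\<forall>z\<in>Z. g z = f z" by (simp add: g_def)
  ultimately show ?thesis by blast
qed

end
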